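(* Let $(\Omega,\mathcal E,P)$ be a probability space, $\mathcal F$ a $\sigma$-subalgebra of $\mathcal E$, and let $f:L^\infty_{\mathcal F}(\mathcal E)\to\bar L^0(\mathcal F)$ be a $\sigma_{\varepsilon,\lambda}(L^\infty_{\mathcal F}(\mathcal E),L^1_{\mathcal F}(\mathcal E))$-lower semicontinuous (or, equivalently, $\sigma_c(L^\infty_{\mathcal F}(\mathcal E),L^1_{\mathcal F}(\mathcal E))$-lower semicontinuous) $L^0(\mathcal F)$-convex $L^\infty_{\mathcal F}(\mathcal E)$-conditional risk measure. Then, for all $x\in L^\infty_{\mathcal F}(\mathcal E)$, $$f(x)=\bigvee\{E(xy|\mathcal F)-f^*(y):\ y\in L^1_{\mathcal F}(\mathcal E),\ y\le0\text{ and }E(y|\mathcal F)=-1\},$$ where $f^*(y)=\bigvee\{E(xy|\mathcal F)-f(x):x\in L^\infty_{\mathcal F}(\mathcal E)\}$ for $y\in L^1_{\mathcal F}(\mathcal E)$.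
   Context: $L^0(\mathcal E)$, $L^0(\mathcal F)$ are the algebras of (a.s.-equality) equivalence classes of real $\mathcal E$-, respectively $\mathcal F$-, measurable random variables with the a.s. order; $L^0_+(\mathcal F)$, $L^0_{++}(\mathcal F)$ are the elements of $L^0(\mathcal F)$ that are $\ge0$, respectively $>0$, a.s. $\bar L^0(\mathcal F)$ is the complete lattice of classes of $[-\infty,\infty]$-valued $\mathcal F$-measurable functions, $\bar L^0_+(\mathcal F)$ its nonnegative elements; $\bigvee,\bigwedge$ are taken there. Conventions: $0\cdot(\pm\infty)=0$, $+\infty\pm(\pm\infty)=+\infty$. For $x\in L^0(\mathcal E)$: $|||x|||_1=E[|x|\,|\mathcal F]$ and $|||x|||_\infty=\bigwedge\{\xi\in\bar L^0_+(\mathcal F):|x|\le\xi\}$; $L^p_{\mathcal F}(\mathcal E)=\{x\in L^0(\mathcal E):|||x|||_p\in L^0_+(\mathcal F)\}$ for $p=1,\infty$, an $L^0(\mathcal F)$-module. For $z\in L^1_{\mathcal F}(\mathcal E)$, $E(z|\mathcal F)=E(z^+|\mathcal F)-E(z^-|\mathcal F)\in L^0(\mathcal F)$; for $x\in L^\infty_{\mathcal F}(\mathcal E)$, $y\in L^1_{\mathcal F}(\mathcal E)$ one has $xy\in L^1_{\mathcal F}(\mathcal E)$. $\sigma_c(L^\infty_{\mathcal F}(\mathcal E),L^1_{\mathcal F}(\mathcal E))$ is the topology on $L^\infty_{\mathcal F}(\mathcal E)$ with local base at $0$ consisting of $\{x:|E(xy_i|\mathcal F)|\le\varepsilon,\ i=1,\dots,n\}$,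 $y_1,\dots,y_n\in L^1_{\mathcal F}(\mathcal E)$, $\varepsilon\in L^0_{++}(\mathcal F)$. $\sigma_{\varepsilon,\lambda}(L^\infty_{\mathcal F}(\mathcal E),L^1_{\mathcal F}(\mathcal E))$ is the linear topology with local base at $0$ consisting of $\{x:P\{\max_i|E(xy_i|\mathcal F)|<\varepsilon\}>1-\lambda\}$, $y_1,\dots,y_n\in L^1_{\mathcal F}(\mathcal E)$, $\varepsilon>0$, $0<\lambda<1$ real. $f:L^\infty_{\mathcal F}(\mathcal E)\to\bar L^0(\mathcal F)$ is proper if $|f(x)|<\infty$ a.s. for some $x$ and $f(x)>-\infty$ a.s. for all $x$; $L^0(\mathcal F)$-convex if $f(\xi x+(1-\xi)y)\le\xi f(x)+(1-\xi)f(y)$ for all $x,y$ and $\xi\in L^0_+(\mathcal F)$, $0\le\xi\le1$. An $L^\infty_{\mathcal F}(\mathcal E)$-conditional risk measure is a proper $f$ that is monotone ($f(x)\le f(y)$ whenever $x\ge y$) and cash invariant ($f(x+y)=f(x)-y$ for $x\in L^\infty_{\mathcal F}(\mathcal E)$, $y\in L^0(\mathcal F)$). A proper $f$ is $\sigma_{\varepsilon,\lambda}$-lower semicontinuous if $\{(x,r):r\in L^0(\mathcal F),f(x)\le r\}$ is closed in the product of $\sigma_{\varepsilon,\lambda}(L^\infty_{\mathcal F}(\mathcal E),L^1_{\mathcal F}(\mathcal E))$ and the topology of convergence in probability on $L^0(\mathcal F)$; it is $\sigma_c$-lower semicontinuous if $\{x:f(x)\le r\}$ is $\sigma_c(L^\infty_{\mathcal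 F}(\mathcal E),L^1_{\mathcal F}(\mathcal E))$-closed for every $r\in L^0(\mathcal F)$. *)

theory Defs
  imports "HOL-Probability.Probability"
begin

text \<open>
  Throughout, \<open>P\<close> is the probability space \<open>(\<Omega>, \<E>, P)\<close>, and \<open>F\<close> is a measure space of which only the
  \<open>\<sigma>\<close>-algebra matters (\<^term>\<open>subalgebra P F\<close>). An element of \<open>L\<^sup>0\<close> is represented by a measurable
  function, and equality and order of classes by almost sure equality and order. A map on classes
  is a map on representatives that respects almost sure equality. The sets of functions used below
  (modules, neighbourhoods, closed sets) are unions of classes, so that each topology on
  representatives is the pullback of the topology on classes.
\<close>

section \<open>Suprema and infima in the lattice of extended-valued classes\<close>

definition is_ess_Sup :: "'a measure \<Rightarrow> 'a measure \<Rightarrow> ('a \<Rightarrow> ereal) set \<Rightarrow> ('a \<Rightarrow> ereal) \<Rightarrow> bool" where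
  "is_ess_Sup P F S g \<longleftrightarrow> g \<in> borel_measurable F \<and>
     (\<forall>h\<in>S. AE \<omega> in P. h \<omega> \<le> g \<omega>) \<and>
     (\<forall>u\<in>borel_measurable F. (\<forall>h\<in>S. AE \<omega> in P. h \<omega> \<le> u \<omega>) \<longrightarrow> (AE \<omega> in P. g \<omega> \<le> u \<omega>))"

definition is_ess_Inf :: "'a measure \<Rightarrow> 'a measure \<Rightarrow> ('a \<Rightarrow> ereal) set \<Rightarrow> ('a \<Rightarrow> ereal) \<Rightarrow> bool" where
  "is_ess_Inf P F S g \<longleftrightarrow> g \<in> borel_measurable F \<and>
     (\<forall>h\<in>S. AE \<omega> in P. g \<omega> \<le> h \<omega>) \<and>
     (\<forall>u\<in>borel_measurable F. (\<forall>h\<in>S. AE \<omega> in P. u \<omega> \<le> h \<omega>) \<longrightarrow> (AE \<omega> in P. u \<omega> \<le> g \<omega>))"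

text \<open>A representative of the supremum (infimum); existence, for families of \<open>F\<close>-measurable
  functions, and almost sure uniqueness are proved below.\<close>

definition ess_Sup :: "'a measure \<Rightarrow> 'a measure \<Rightarrow> ('a \<Rightarrow> ereal) set \<Rightarrow> 'a \<Rightarrow> ereal" where
  "ess_Sup P F S = (SOME g. is_ess_Sup P F S g)"

definition ess_Inf :: "'a measure \<Rightarrow> 'a measure \<Rightarrow> ('a \<Rightarrow> ereal) set \<Rightarrow> 'a \<Rightarrow> ereal" where
  "ess_Inf P F S = (SOME g. is_ess_Inf P F S g)"

lemma is_ess_Sup_unique:
  assumes "is_ess_Sup P F S g" "is_ess_Sup P F S h"
  shows "AE \<omega> in P. g \<omega> = h \<omega>"
proof -
  have "AE \<omega> in P. g \<omega> \<le> h \<omega>" "AE \<omega> in P. h \<omega> \<le> g \<omega>"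
    using assms unfolding is_ess_Sup_def by blast+
  then show ?thesis by eventually_elim auto
qed

lemma is_ess_Inf_unique:
  assumes "is_ess_Inf P F S g" "is_ess_Inf P F S h"
  shows "AE \<omega> in P. g \<omega> = h \<omega>"
proof -
  have "AE \<omega> in P. g \<omega> \<le> h \<omega>" "AE \<omega> in P. h \<omega> \<le> g \<omega>"
    using assms unfolding is_ess_Inf_def by blast+
  then show ?thesis by eventually_elim auto
qed

lemma is_ess_Sup_exists:
  assumes "prob_space P" and sub: "subalgebra P F" and S: "S \<subseteq> borel_measurable F"
  shows "\<exists>g. is_ess_Sup P F S g"
proof -
  interpret prob_space P by fact
  define m where "m C q = emeasure P {\<omega> \<in> space P. ereal q < (SUP g\<in>C. g \<omega>)}"
    for C :: "('a \<Rightarrow> ereal) set" and q :: real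
  have meas: "(\<lambda>\<omega>. SUP g\<in>C. g \<omega>) \<in> borel_measurable F" if "countable C" "C \<subseteq> S" for C
    using that S by (intro borel_measurable_SUP) auto
  have measP: "g \<in> borel_measurable P" if "g \<in> borel_measurable F" for g :: "'a \<Rightarrow> ereal"
    using measurable_from_subalg[OF sub that] .
  have sets: "{\<omega> \<in> space P. ereal q < (SUP g\<in>C. g \<omega>)} \<in> sets P" if "countable C" "C \<subseteq> S" for C q
    using measP[OF meas[OF that]] by measurable
  have "\<exists>C. countable C \<and> C \<subseteq> S \<and> (\<forall>D. countable D \<and> D \<subseteq> S \<longrightarrow> m D q \<le> m C q)" for q
  proof -
    let ?A = "{C. countable C \<and> C \<subseteq> S}"
    have "?A \<noteq> {}" by auto
    then obtain a :: "nat \<Rightarrow> ennreal"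
      where a: "range a \<subseteq> (\<lambda>C. m C q) ` ?A" "(SUP C\<in>?A. m C q) = (SUP i. a i)"
      using ennreal_SUP_countable_SUP[of ?A "\<lambda>C. m C q"] by auto
    then have "\<forall>i. \<exists>C. C \<in> ?A \<and> a i = m C q" by blast
    then obtain K where K: "\<And>i. K i \<in> ?A" "\<And>i. a i = m (K i) q" by metis
    have U: "(\<Union>i. K i) \<in> ?A" using K(1) by auto
    have le: "a i \<le> m (\<Union>i. K i) q" for i
      unfolding K(2) m_def
    proof (rule emeasure_mono)
      show "{\<omega> \<in> space P. ereal q < (SUP g\<in>\<Union>i. K i. g \<omega>)} \<in> sets P" using U by (intro sets) auto
    qed (auto simp: less_SUP_iff)
    have "m D q \<le> m (\<Union>i. K i) q" if "D \<in> ?A" for D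
    proof -
      have "m D q \<le> (SUP C\<in>?A. m C q)" using that by (rule SUP_upper)
      also have "\<dots> \<le> m (\<Union>i. K i) q" unfolding a(2) by (rule SUP_least) (rule le)
      finally show ?thesis .
    qed
    with U show ?thesis by blast
  qed
  then obtain K where K: "\<And>q. countable (K q)" "\<And>q. K q \<subseteq> S"
    and Kmax: "\<And>q D. countable D \<Longrightarrow> D \<subseteq> S \<Longrightarrow> m D q \<le> m (K q) q" by metis
  define C where "C = (\<Union>q\<in>\<rat>. K q)"
  have C: "countable C" "C \<subseteq> S"
    unfolding C_def using K countable_rat by auto
  let ?g = "\<lambda>\<omega>. SUP g\<in>C. g \<omega>"
  have "AE \<omega> in P. h \<omega> \<le> ?g \<omega>" if h: "h \<in> S" for h
  proof -
    let ?D = "insert h C"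
    have D: "countable ?D" "?D \<subseteq> S" using C h by auto
    have "AE \<omega> in P. \<not> (ereal q < h \<omega> \<and> \<not> ereal q < ?g \<omega>)" if q: "q \<in> \<rat>" for q
    proof -
      let ?A = "{\<omega> \<in> space P. ereal q < ?g \<omega>}"
      let ?B = "{\<omega> \<in> space P. ereal q < (SUP g\<in>?D. g \<omega>)}"
      have AB: "?A \<subseteq> ?B" by (auto simp: less_SUP_iff less_max_iff_disj)
      have "emeasure P ?B \<le> emeasure P {\<omega> \<in> space P. ereal q < (SUP g\<in>K q. g \<omega>)}"
        using Kmax[OF D, of q] by (simp add: m_def)
      also have "\<dots> \<le> emeasure P ?A"
        by (rule emeasure_mono[OF _ sets[OF C]]) (use q in \<open>auto simp: less_SUP_iff C_def\<close>)
      finally have le: "emeasure P ?B \<le> emeasure P ?A" .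
      have "emeasure P (?B - ?A) = emeasure P ?B - emeasure P ?A"
        by (rule emeasure_Diff[OF _ sets[OF D] sets[OF C] AB]) simp
      also have "\<dots> = 0" by (rule diff_eq_0_ennreal[OF _ le]) (simp add: less_top[symmetric])
      finally have "emeasure P (?B - ?A) = 0" .
      then have "?B - ?A \<in> null_sets P" using sets[OF C] sets[OF D] by auto
      then have "AE \<omega> in P. \<omega> \<notin> ?B - ?A" by (rule AE_not_in)
      then show ?thesis
        by (rule AE_mp) (auto intro!: AE_I2 simp: less_SUP_iff less_max_iff_disj)
    qed
    then have "AE \<omega> in P. \<forall>q\<in>\<rat>. \<not> (ereal q < h \<omega> \<and> \<not> ereal q < ?g \<omega>)"
      by (subst AE_ball_countable) (auto simp: countable_rat)
    then show ?thesis
    proof (rule AE_mp, intro AE_I2 impI)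
      fix \<omega> assume *: "\<forall>q\<in>\<rat>. \<not> (ereal q < h \<omega> \<and> \<not> ereal q < ?g \<omega>)"
      show "h \<omega> \<le> ?g \<omega>"
      proof (rule ccontr)
        assume "\<not> h \<omega> \<le> ?g \<omega>"
        then have "?g \<omega> < h \<omega>" by simp
        then obtain r where r: "?g \<omega> < ereal (real_of_rat r)" "ereal (real_of_rat r) < h \<omega>"
          using ereal_dense3 by blast
        then show False using * Rats_of_rat[of r] by (meson less_asym)
      qed
    qed
  qed
  moreover have "AE \<omega> in P. ?g \<omega> \<le> u \<omega>" if u: "\<forall>h\<in>S. AE \<omega> in P. h \<omega> \<le> u \<omega>" for u
  proof -
    have "AE \<omega> in P. \<forall>h\<in>C. h \<omega> \<le> u \<omega>"
      using u C by (subst AE_ball_countable) auto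
    then show ?thesis by eventually_elim (auto intro: SUP_least)
  qed
  ultimately show ?thesis
    unfolding is_ess_Sup_def using meas[OF C] by blast
qed

lemma is_ess_Inf_exists:
  assumes "prob_space P" "subalgebra P F" "S \<subseteq> borel_measurable F"
  shows "\<exists>g. is_ess_Inf P F S g"
proof -
  have "(\<lambda>h \<omega>. - h \<omega>) ` S \<subseteq> borel_measurable F" using assms(3) by auto
  from is_ess_Sup_exists[OF assms(1,2) this] obtain g
    where g: "is_ess_Sup P F ((\<lambda>h \<omega>. - h \<omega>) ` S) g" ..
  have "AE \<omega> in P. u \<omega> \<le> - g \<omega>"
    if u: "u \<in> borel_measurable F" and h: "\<forall>h\<in>S. AE \<omega> in P. u \<omega> \<le> h \<omega>" for u
  proof -
    have "(\<lambda>\<omega>. - u \<omega>) \<in> borel_measurable F" using u by auto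
    moreover have "\<forall>h\<in>(\<lambda>h \<omega>. - h \<omega>) ` S. AE \<omega> in P. h \<omega> \<le> - u \<omega>" using h by auto
    ultimately have "AE \<omega> in P. g \<omega> \<le> - u \<omega>"
      by (rule g[unfolded is_ess_Sup_def, THEN conjunct2, THEN conjunct2, THEN bspec, THEN mp])
    then show ?thesis by eventually_elim (metis ereal_minus_le_minus ereal_uminus_uminus)
  qed
  moreover have "AE \<omega> in P. - g \<omega> \<le> h \<omega>" if "h \<in> S" for h
  proof -
    have "AE \<omega> in P. - h \<omega> \<le> g \<omega>" using g that unfolding is_ess_Sup_def by auto
    then show ?thesis by eventually_elim (simp add: ereal_uminus_le_reorder)
  qed
  moreover have "(\<lambda>\<omega>. - g \<omega>) \<in> borel_measurable F" using g unfolding is_ess_Sup_def by auto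
  ultimately show ?thesis unfolding is_ess_Inf_def by blast
qed

section \<open>The conditional \<open>L\<^sup>1\<close> and \<open>L\<^sup>\<infinity>\<close> modules\<close>

definition cond_norm1 :: "'a measure \<Rightarrow> 'a measure \<Rightarrow> ('a \<Rightarrow> real) \<Rightarrow> 'a \<Rightarrow> ennreal" where
  "cond_norm1 P F x = nn_cond_exp P F (\<lambda>\<omega>. ennreal \<bar>x \<omega>\<bar>)"

definition cond_norm_inf :: "'a measure \<Rightarrow> 'a measure \<Rightarrow> ('a \<Rightarrow> real) \<Rightarrow> 'a \<Rightarrow> ereal" where
  "cond_norm_inf P F x = ess_Inf P F
     {\<xi> \<in> borel_measurable F. (AE \<omega> in P. 0 \<le> \<xi> \<omega>) \<and> (AE \<omega> in P. ereal \<bar>x \<omega>\<bar> \<le> \<xi> \<omega>)}"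

definition L1_cond :: "'a measure \<Rightarrow> 'a measure \<Rightarrow> ('a \<Rightarrow> real) set" where
  "L1_cond P F = {x \<in> borel_measurable P. AE \<omega> in P. cond_norm1 P F x \<omega> < \<infinity>}"

definition Linf_cond :: "'a measure \<Rightarrow> 'a measure \<Rightarrow> ('a \<Rightarrow> real) set" where
  "Linf_cond P F = {x \<in> borel_measurable P. AE \<omega> in P. 0 \<le> cond_norm_inf P F x \<omega> \<and> cond_norm_inf P F x \<omega> < \<infinity>}"

text \<open>The library's \<^const>\<open>real_cond_exp\<close> is defined as the difference of the (finite parts of the)
  conditional expectations of positive and negative part, hence is the required extension of the
  conditional expectation to all of \<^const>\<open>L1_cond\<close>, integrable or not. The following is \<open>E(xy|F)\<close>.\<close>

definition cond_pairing :: "'a measure \<Rightarrow> 'a measure \<Rightarrow> ('a \<Rightarrow> real) \<Rightarrow> ('a \<Rightarrow> real) \<Rightarrow> 'a \<Rightarrow> real" where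
  "cond_pairing P F x y = real_cond_exp P F (\<lambda>\<omega>. x \<omega> * y \<omega>)"

section \<open>Topologies given by a local base at zero\<close>

definition local_base_topology :: "('a \<Rightarrow> real) set \<Rightarrow> ('a \<Rightarrow> real) set set \<Rightarrow> ('a \<Rightarrow> real) topology" where
  "local_base_topology V B =
     topology (\<lambda>U. U \<subseteq> V \<and> (\<forall>x\<in>U. \<exists>N\<in>B. (\<lambda>z \<omega>. x \<omega> + z \<omega>) ` N \<subseteq> U))"

lemma openin_local_base_topology:
  assumes "B \<noteq> {}" and fil: "\<And>N N'. N \<in> B \<Longrightarrow> N' \<in> B \<Longrightarrow> \<exists>K\<in>B. K \<subseteq> N \<inter> N'"
  shows "openin (local_base_topology V B) U \<longleftrightarrow>
    U \<subseteq> V \<and> (\<forall>x\<in>U. \<exists>N\<in>B. (\<lambda>z \<omega>. x \<omega> + z \<omega>) ` N \<subseteq> U)"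
proof -
  have "istopology (\<lambda>U. U \<subseteq> V \<and> (\<forall>x\<in>U. \<exists>N\<in>B. (\<lambda>z \<omega>. x \<omega> + z \<omega>) ` N \<subseteq> U))"
    unfolding istopology_def
  proof (intro conjI allI impI ballI; (elim conjE)?)
    fix S T x
    assume "\<forall>x\<in>S. \<exists>N\<in>B. (\<lambda>z \<omega>. x \<omega> + z \<omega>) ` N \<subseteq> S" "\<forall>x\<in>T. \<exists>N\<in>B. (\<lambda>z \<omega>. x \<omega> + z \<omega>) ` N \<subseteq> T"
      and "x \<in> S \<inter> T"
    then obtain N N' where N: "N \<in> B" "N' \<in> B" "(\<lambda>z \<omega>. x \<omega> + z \<omega>) ` N \<subseteq> S" "(\<lambda>z \<omega>. x \<omega> + z \<omega>) ` N' \<subseteq> T"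
      by blast
    obtain K where "K \<in> B" "K \<subseteq> N \<inter> N'" using fil[OF N(1,2)] by blast
    then have "(\<lambda>z \<omega>. x \<omega> + z \<omega>) ` K \<subseteq> S \<inter> T" using N(3,4) by blast
    with \<open>K \<in> B\<close> show "\<exists>N\<in>B. (\<lambda>z \<omega>. x \<omega> + z \<omega>) ` N \<subseteq> S \<inter> T" by blast
  next
    fix \<K> :: "('a \<Rightarrow> real) set set" and x
    assume "\<forall>K\<in>\<K>. K \<subseteq> V \<and> (\<forall>x\<in>K. \<exists>N\<in>B. (\<lambda>z \<omega>. x \<omega> + z \<omega>) ` N \<subseteq> K)" "x \<in> \<Union>\<K>"
    then obtain K N where "K \<in> \<K>" "N \<in> B" "(\<lambda>z \<omega>. x \<omega> + z \<omega>) ` N \<subseteq> K" by blast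
    then show "\<exists>N\<in>B. (\<lambda>z \<omega>. x \<omega> + z \<omega>) ` N \<subseteq> \<Union>\<K>" by blast
  qed auto
  then show ?thesis by (simp add: local_base_topology_def topology_inverse')
qed

definition sigma_c_nbhd :: "'a measure \<Rightarrow> 'a measure \<Rightarrow> ('a \<Rightarrow> real) set \<Rightarrow> ('a \<Rightarrow> real) \<Rightarrow> ('a \<Rightarrow> real) set" where
  "sigma_c_nbhd P F Y \<epsilon> =
     {x \<in> Linf_cond P F. \<forall>y\<in>Y. AE \<omega> in P. \<bar>cond_pairing P F x y \<omega>\<bar> \<le> \<epsilon> \<omega>}"

definition sigma_c_base :: "'a measure \<Rightarrow> 'a measure \<Rightarrow> ('a \<Rightarrow> real) set set" where
  "sigma_c_base P F = {sigma_c_nbhd P F Y \<epsilon> | Y \<epsilon>.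
     finite Y \<and> Y \<noteq> {} \<and> Y \<subseteq> L1_cond P F \<and> \<epsilon> \<in> borel_measurable F \<and> (AE \<omega> in P. 0 < \<epsilon> \<omega>)}"

definition sigma_c :: "'a measure \<Rightarrow> 'a measure \<Rightarrow> ('a \<Rightarrow> real) topology" where
  "sigma_c P F = local_base_topology (Linf_cond P F) (sigma_c_base P F)"

definition sigma_el_nbhd :: "'a measure \<Rightarrow> 'a measure \<Rightarrow> ('a \<Rightarrow> real) set \<Rightarrow> real \<Rightarrow> real \<Rightarrow> ('a \<Rightarrow> real) set" where
  "sigma_el_nbhd P F Y \<epsilon> \<delta> =
     {x \<in> Linf_cond P F. measure P {\<omega> \<in> space P. (MAX y\<in>Y. \<bar>cond_pairing P F x y \<omega>\<bar>) < \<epsilon>} > 1 - \<delta>}"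

definition sigma_el_base :: "'a measure \<Rightarrow> 'a measure \<Rightarrow> ('a \<Rightarrow> real) set set" where
  "sigma_el_base P F = {sigma_el_nbhd P F Y \<epsilon> \<delta> | Y \<epsilon> \<delta>.
     finite Y \<and> Y \<noteq> {} \<and> Y \<subseteq> L1_cond P F \<and> 0 < \<epsilon> \<and> 0 < \<delta> \<and> \<delta> < 1}"

definition sigma_el :: "'a measure \<Rightarrow> 'a measure \<Rightarrow> ('a \<Rightarrow> real) topology" where
  "sigma_el P F = local_base_topology (Linf_cond P F) (sigma_el_base P F)"

text \<open>The topology of convergence in probability on \<open>L\<^sup>0(F)\<close>.\<close>

definition prob_nbhd :: "'a measure \<Rightarrow> 'a measure \<Rightarrow> real \<Rightarrow> real \<Rightarrow> ('a \<Rightarrow> real) set" where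
  "prob_nbhd P F \<epsilon> \<delta> =
     {r \<in> borel_measurable F. measure P {\<omega> \<in> space P. \<bar>r \<omega>\<bar> < \<epsilon>} > 1 - \<delta>}"

definition prob_base :: "'a measure \<Rightarrow> 'a measure \<Rightarrow> ('a \<Rightarrow> real) set set" where
  "prob_base P F = {prob_nbhd P F \<epsilon> \<delta> | \<epsilon> \<delta>. 0 < \<epsilon> \<and> 0 < \<delta> \<and> \<delta> < 1}"

definition prob_topology :: "'a measure \<Rightarrow> 'a measure \<Rightarrow> ('a \<Rightarrow> real) topology" where
  "prob_topology P F = local_base_topology (borel_measurable F) (prob_base P F)"

text \<open>The three families are filter bases, so \<^const>\<open>local_base_topology\<close> yields the intended
  open sets (see \<open>openin_local_base_topology\<close>).\<close>

lemma zero_in_L1_cond: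
  assumes "prob_space P" "subalgebra P F"
  shows "(\<lambda>_. 0) \<in> L1_cond P F"
proof -
  interpret prob_space P by fact
  interpret finite_measure_subalgebra P F
    by unfold_locales (fact assms(2))
  have "AE \<omega> in P. (0 :: ennreal) = nn_cond_exp P F (\<lambda>_. 0) \<omega>"
    by (rule nn_cond_exp_F_meas) auto
  then show ?thesis by (auto simp: L1_cond_def cond_norm1_def elim: eventually_mono)
qed

lemma sigma_c_base_filter:
  assumes "prob_space P" "subalgebra P F"
  shows "sigma_c_base P F \<noteq> {}"
    and "\<And>N N'. N \<in> sigma_c_base P F \<Longrightarrow> N' \<in> sigma_c_base P F \<Longrightarrow>
           \<exists>K\<in>sigma_c_base P F. K \<subseteq> N \<inter> N'"
proof -
  have "sigma_c_nbhd P F {\<lambda>_. 0} (\<lambda>_. 1) \<in> sigma_c_base P F"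
    unfolding sigma_c_base_def using zero_in_L1_cond[OF assms]
    by (intro CollectI exI[of _ "{\<lambda>_. 0}"] exI[of _ "\<lambda>_. 1"]) auto
  then show "sigma_c_base P F \<noteq> {}" by auto
next
  fix N N' assume "N \<in> sigma_c_base P F" "N' \<in> sigma_c_base P F"
  then obtain Y \<epsilon> Y' \<epsilon>' where
    N: "N = sigma_c_nbhd P F Y \<epsilon>" "finite Y" "Y \<noteq> {}" "Y \<subseteq> L1_cond P F"
       "\<epsilon> \<in> borel_measurable F" "AE \<omega> in P. 0 < \<epsilon> \<omega>"
    and N': "N' = sigma_c_nbhd P F Y' \<epsilon>'" "finite Y'" "Y' \<subseteq> L1_cond P F"
       "\<epsilon>' \<in> borel_measurable F" "AE \<omega> in P. 0 < \<epsilon>' \<omega>"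
    unfolding sigma_c_base_def by blast
  let ?K = "sigma_c_nbhd P F (Y \<union> Y') (\<lambda>\<omega>. min (\<epsilon> \<omega>) (\<epsilon>' \<omega>))"
  have "AE \<omega> in P. 0 < min (\<epsilon> \<omega>) (\<epsilon>' \<omega>)" using N(6) N'(5) by eventually_elim auto
  then have "?K \<in> sigma_c_base P F"
    unfolding sigma_c_base_def using N N'
    by (intro CollectI exI[of _ "Y \<union> Y'"] exI[of _ "\<lambda>\<omega>. min (\<epsilon> \<omega>) (\<epsilon>' \<omega>)"]) auto
  moreover have "?K \<subseteq> N \<inter> N'"
    unfolding N(1) N'(1) sigma_c_nbhd_def by (auto elim: eventually_mono)
  ultimately show "\<exists>K\<in>sigma_c_base P F. K \<subseteq> N \<inter> N'" by blast
qed

lemma sigma_el_base_filter: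
  assumes "prob_space P" "subalgebra P F"
  shows "sigma_el_base P F \<noteq> {}"
    and "\<And>N N'. N \<in> sigma_el_base P F \<Longrightarrow> N' \<in> sigma_el_base P F \<Longrightarrow>
           \<exists>K\<in>sigma_el_base P F. K \<subseteq> N \<inter> N'"
proof -
  have "sigma_el_nbhd P F {\<lambda>_. 0} 1 (1/2) \<in> sigma_el_base P F"
    unfolding sigma_el_base_def using zero_in_L1_cond[OF assms]
    by (intro CollectI exI[of _ "{\<lambda>_. 0}"] exI[of _ 1] exI[of _ "1/2"]) auto
  then show "sigma_el_base P F \<noteq> {}" by auto
next
  interpret prob_space P by fact
  fix N N' assume "N \<in> sigma_el_base P F" "N' \<in> sigma_el_base P F"
  then obtain Y \<epsilon> \<delta> Y' \<epsilon>' \<delta>' where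
    N: "N = sigma_el_nbhd P F Y \<epsilon> \<delta>" "finite Y" "Y \<noteq> {}" "Y \<subseteq> L1_cond P F"
       "0 < \<epsilon>" "0 < \<delta>" "\<delta> < 1"
    and N': "N' = sigma_el_nbhd P F Y' \<epsilon>' \<delta>'" "finite Y'" "Y' \<noteq> {}" "Y' \<subseteq> L1_cond P F"
       "0 < \<epsilon>'" "0 < \<delta>'" "\<delta>' < 1"
    unfolding sigma_el_base_def by blast
  let ?S = "\<lambda>x Y \<epsilon>. {\<omega> \<in> space P. (MAX y\<in>Y. \<bar>cond_pairing P F x y \<omega>\<bar>) < \<epsilon>}"
  have eq: "?S x Y \<epsilon> = {\<omega> \<in> space P. \<forall>y\<in>Y. \<bar>cond_pairing P F x y \<omega>\<bar> < \<epsilon>}"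
    if "finite Y" "Y \<noteq> {}" for x Y \<epsilon>
    using that by (simp add: Max_less_iff)
  have sets: "?S x Y \<epsilon> \<in> sets P" if "finite Y" "Y \<noteq> {}" for x Y \<epsilon>
    unfolding eq[OF that] cond_pairing_def using that(1) by measurable
  let ?K = "sigma_el_nbhd P F (Y \<union> Y') (min \<epsilon> \<epsilon>') (min \<delta> \<delta>')"
  have "?K \<in> sigma_el_base P F"
    unfolding sigma_el_base_def using N N'
    by (intro CollectI exI[of _ "Y \<union> Y'"] exI[of _ "min \<epsilon> \<epsilon>'"] exI[of _ "min \<delta> \<delta>'"]) auto
  moreover have "?K \<subseteq> N \<inter> N'"
  proof
    fix x assume x: "x \<in> ?K"
    have "measure P (?S x (Y \<union> Y') (min \<epsilon> \<epsilon>')) \<le> measure P (?S x Y \<epsilon>)"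
      using N N' by (intro finite_measure_mono sets) (auto simp: eq)
    moreover have "measure P (?S x (Y \<union> Y') (min \<epsilon> \<epsilon>')) \<le> measure P (?S x Y' \<epsilon>')"
      using N N' by (intro finite_measure_mono sets) (auto simp: eq)
    ultimately show "x \<in> N \<inter> N'"
      using x unfolding N(1) N'(1) sigma_el_nbhd_def Int_iff mem_Collect_eq by linarith
  qed
  ultimately show "\<exists>K\<in>sigma_el_base P F. K \<subseteq> N \<inter> N'" by blast
qed

lemma prob_base_filter:
  assumes "prob_space P" "subalgebra P F"
  shows "prob_base P F \<noteq> {}"
    and "\<And>N N'. N \<in> prob_base P F \<Longrightarrow> N' \<in> prob_base P F \<Longrightarrow> \<exists>K\<in>prob_base P F. K \<subseteq> N \<inter> N'"
proof -
  have "prob_nbhd P F 1 (1/2) \<in> prob_base P F"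
    unfolding prob_base_def by (intro CollectI exI[of _ 1] exI[of _ "1/2"]) auto
  then show "prob_base P F \<noteq> {}" by auto
next
  interpret prob_space P by fact
  fix N N' assume "N \<in> prob_base P F" "N' \<in> prob_base P F"
  then obtain \<epsilon> \<delta> \<epsilon>' \<delta>' where
    N: "N = prob_nbhd P F \<epsilon> \<delta>" "0 < \<epsilon>" "0 < \<delta>" "\<delta> < 1"
    and N': "N' = prob_nbhd P F \<epsilon>' \<delta>'" "0 < \<epsilon>'" "0 < \<delta>'" "\<delta>' < 1"
    unfolding prob_base_def by blast
  let ?K = "prob_nbhd P F (min \<epsilon> \<epsilon>') (min \<delta> \<delta>')"
  have "?K \<in> prob_base P F"
    unfolding prob_base_def using N N'
    by (intro CollectI exI[of _ "min \<epsilon> \<epsilon>'"] exI[of _ "min \<delta> \<delta>'"]) auto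
  moreover have "?K \<subseteq> N \<inter> N'"
  proof
    fix r assume r: "r \<in> ?K"
    then have "r \<in> borel_measurable F" by (simp add: prob_nbhd_def)
    then have [measurable]: "r \<in> borel_measurable P"
      by (rule measurable_from_subalg[OF assms(2)])
    let ?S = "\<lambda>\<epsilon>. {\<omega> \<in> space P. \<bar>r \<omega>\<bar> < \<epsilon>}"
    have "measure P (?S (min \<epsilon> \<epsilon>')) \<le> measure P (?S \<epsilon>)"
      by (intro finite_measure_mono) auto
    moreover have "measure P (?S (min \<epsilon> \<epsilon>')) \<le> measure P (?S \<epsilon>')"
      by (intro finite_measure_mono) auto
    ultimately show "r \<in> N \<inter> N'"
      using r unfolding N(1) N'(1) prob_nbhd_def Int_iff mem_Collect_eq by linarith
  qed
  ultimately show "\<exists>K\<in>prob_base P F. K \<subseteq> N \<inter> N'" by blast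
qed

section \<open>Conditional risk measures\<close>

text \<open>\<open>f\<close> induces a map from the classes of \<^const>\<open>Linf_cond\<close> to the extended-valued \<open>F\<close>-measurable
  classes.\<close>

definition class_function :: "'a measure \<Rightarrow> 'a measure \<Rightarrow> (('a \<Rightarrow> real) \<Rightarrow> 'a \<Rightarrow> ereal) \<Rightarrow> bool" where
  "class_function P F f \<longleftrightarrow>
     (\<forall>x\<in>Linf_cond P F. f x \<in> borel_measurable F) \<and>
     (\<forall>x\<in>Linf_cond P F. \<forall>x'\<in>Linf_cond P F.
        (AE \<omega> in P. x \<omega> = x' \<omega>) \<longrightarrow> (AE \<omega> in P. f x \<omega> = f x' \<omega>))"

definition proper :: "'a measure \<Rightarrow> 'a measure \<Rightarrow> (('a \<Rightarrow> real) \<Rightarrow> 'a \<Rightarrow> ereal) \<Rightarrow> bool" where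
  "proper P F f \<longleftrightarrow>
     (\<exists>x\<in>Linf_cond P F. AE \<omega> in P. \<bar>f x \<omega>\<bar> < \<infinity>) \<and>
     (\<forall>x\<in>Linf_cond P F. AE \<omega> in P. - \<infinity> < f x \<omega>)"

definition L0_convex :: "'a measure \<Rightarrow> 'a measure \<Rightarrow> (('a \<Rightarrow> real) \<Rightarrow> 'a \<Rightarrow> ereal) \<Rightarrow> bool" where
  "L0_convex P F f \<longleftrightarrow>
     (\<forall>x\<in>Linf_cond P F. \<forall>y\<in>Linf_cond P F. \<forall>\<xi>\<in>borel_measurable F.
        (AE \<omega> in P. 0 \<le> \<xi> \<omega> \<and> \<xi> \<omega> \<le> 1) \<longrightarrow>
        (AE \<omega> in P. f (\<lambda>\<omega>. \<xi> \<omega> * x \<omega> + (1 - \<xi> \<omega>) * y \<omega>) \<omega>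
                      \<le> ereal (\<xi> \<omega>) * f x \<omega> + ereal (1 - \<xi> \<omega>) * f y \<omega>))"

definition monotone_rm :: "'a measure \<Rightarrow> 'a measure \<Rightarrow> (('a \<Rightarrow> real) \<Rightarrow> 'a \<Rightarrow> ereal) \<Rightarrow> bool" where
  "monotone_rm P F f \<longleftrightarrow>
     (\<forall>x\<in>Linf_cond P F. \<forall>y\<in>Linf_cond P F.
        (AE \<omega> in P. y \<omega> \<le> x \<omega>) \<longrightarrow> (AE \<omega> in P. f x \<omega> \<le> f y \<omega>))"

definition cash_invariant :: "'a measure \<Rightarrow> 'a measure \<Rightarrow> (('a \<Rightarrow> real) \<Rightarrow> 'a \<Rightarrow> ereal) \<Rightarrow> bool" where
  "cash_invariant P F f \<longleftrightarrow>
     (\<forall>x\<in>Linf_cond P F. \<forall>y\<in>borel_measurable F.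
        AE \<omega> in P. f (\<lambda>\<omega>. x \<omega> + y \<omega>) \<omega> = f x \<omega> - ereal (y \<omega>))"

definition cond_risk_measure :: "'a measure \<Rightarrow> 'a measure \<Rightarrow> (('a \<Rightarrow> real) \<Rightarrow> 'a \<Rightarrow> ereal) \<Rightarrow> bool" where
  "cond_risk_measure P F f \<longleftrightarrow>
     class_function P F f \<and> proper P F f \<and> monotone_rm P F f \<and> cash_invariant P F f"

definition lsc_sigma_el :: "'a measure \<Rightarrow> 'a measure \<Rightarrow> (('a \<Rightarrow> real) \<Rightarrow> 'a \<Rightarrow> ereal) \<Rightarrow> bool" where
  "lsc_sigma_el P F f \<longleftrightarrow>
     closedin (prod_topology (sigma_el P F) (prob_topology P F))
       {(x, r). x \<in> Linf_cond P F \<and> r \<in> borel_measurable F \<and> (AE \<omega> in P. f x \<omega> \<le> ereal (r \<omega>))}"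

definition lsc_sigma_c :: "'a measure \<Rightarrow> 'a measure \<Rightarrow> (('a \<Rightarrow> real) \<Rightarrow> 'a \<Rightarrow> ereal) \<Rightarrow> bool" where
  "lsc_sigma_c P F f \<longleftrightarrow>
     (\<forall>r\<in>borel_measurable F.
        closedin (sigma_c P F) {x \<in> Linf_cond P F. AE \<omega> in P. f x \<omega> \<le> ereal (r \<omega>)})"

definition cond_conjugate ::
    "'a measure \<Rightarrow> 'a measure \<Rightarrow> (('a \<Rightarrow> real) \<Rightarrow> 'a \<Rightarrow> ereal) \<Rightarrow> ('a \<Rightarrow> real) \<Rightarrow> 'a \<Rightarrow> ereal" where
  "cond_conjugate P F f y =
     ess_Sup P F {(\<lambda>\<omega>. ereal (cond_pairing P F x y \<omega>) - f x \<omega>) | x. x \<in> Linf_cond P F}"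

end

theory Submission
  imports Defs
begin

text \<open>
  Cash invariance reduces everything to the acceptance set \<open>{f \<le> 0}\<close>. If the representation failed
  at \<open>x\<close>, some translate \<open>x1\<close> of \<open>x\<close> would lie outside this set, hence so would a basic
  \<open>\<sigma>\<^sub>c\<close>-neighbourhood of \<open>x1\<close> given by finitely many \<open>y\<^sub>1, \<dots>, y\<^sub>n\<close>. The separation is thereby a
  problem in \<open>L\<^sup>0(F)\<^sup>n\<close>, where no Hahn-Banach theorem is needed: the acceptance set is stable under
  countable \<open>F\<close>-measurable gluing, so the conditional distance is approached by a single sequence, and
  the parallelogram law makes it converge almost surely. The limit \<open>u\<close> satisfies the variational
  inequality of a projection, and \<open>\<Sum> u\<^sub>i y\<^sub>i\<close>, negated and normalised, is an element of the dual
  whose value exceeds the supposed supremum.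

  The equivalence of the two semicontinuity notions goes in a circle: \<open>\<sigma>\<^sub>\<epsilon>\<^sub>,\<^sub>\<lambda>\<close>-lower semicontinuity
  implies \<open>\<sigma>\<^sub>c\<close>-lower semicontinuity because \<open>\<sigma>\<^sub>c\<close> is finer, the latter implies the representation,
  and a supremum of \<open>\<sigma>\<^sub>\<epsilon>\<^sub>,\<^sub>\<lambda>\<close>-continuous functions is \<open>\<sigma>\<^sub>\<epsilon>\<^sub>,\<^sub>\<lambda>\<close>-lower semicontinuous.
\<close>

section \<open>Conditional expectation on \<^const>\<open>L1_cond\<close>\<close>

locale cond_prob_space = prob_space P + finite_measure_subalgebra P F
  for P F :: "'a measure"
begin

lemma measurable_F: "h \<in> measurable F N \<Longrightarrow> h \<in> measurable P N"
  by (rule measurable_from_subalg[OF subalg])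

lemma sets_F: "A \<in> sets F \<Longrightarrow> A \<in> sets P"
  using subalg by (auto simp: subalgebra_def)

lemma space_F: "space F = space P"
  using subalg by (auto simp: subalgebra_def)

text \<open>Only measurability of \<open>y\<close> is assumed, so the identity is proved for
  \<open>nn_cond_exp\<close> on positive and negative parts. At each point one of the two parts of
  \<open>\<xi>\<close> vanishes, and \<open>enn2real\<close> is multiplicative even at infinity, so
  no difference of infinite values has to be interpreted.\<close>

lemma real_cond_exp_F_mult:
  assumes \<xi>: "\<xi> \<in> borel_measurable F" and y: "y \<in> borel_measurable P"
  shows "AE \<omega> in P. real_cond_exp P F (\<lambda>\<omega>. \<xi> \<omega> * y \<omega>) \<omega> = \<xi> \<omega> * real_cond_exp P F y \<omega>"
proof -
  have \<xi>P: "\<xi> \<in> borel_measurable P" using \<xi> by (rule measurable_F)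
  have *: "AE \<omega> in P. nn_cond_exp P F (\<lambda>\<omega>. ennreal (\<xi> \<omega> * z \<omega>)) \<omega> =
      ennreal (\<xi> \<omega>) * nn_cond_exp P F (\<lambda>\<omega>. ennreal (z \<omega>)) \<omega>
      + ennreal (- \<xi> \<omega>) * nn_cond_exp P F (\<lambda>\<omega>. ennreal (- z \<omega>)) \<omega>"
    if z: "z \<in> borel_measurable P" for z
  proof -
    \<comment> \<open>\<open>ennreal\<close> truncates negative reals to 0, hence acts as the
      positive part: the positive part of a product is the sum of the products of parts with equal
      sign.\<close>
    have eq: "(\<lambda>\<omega>. ennreal (\<xi> \<omega> * z \<omega>)) =
      (\<lambda>\<omega>. ennreal (\<xi> \<omega>) * ennreal (z \<omega>) + ennreal (- \<xi> \<omega>) * ennreal (- z \<omega>))"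
    proof
      fix \<omega>
      consider "\<xi> \<omega> \<ge> 0" "z \<omega> \<ge> 0" | "\<xi> \<omega> \<ge> 0" "z \<omega> < 0" | "\<xi> \<omega> < 0" "z \<omega> \<ge> 0" | "\<xi> \<omega> < 0" "z \<omega> < 0"
        by linarith
      then show "ennreal (\<xi> \<omega> * z \<omega>) =
          ennreal (\<xi> \<omega>) * ennreal (z \<omega>) + ennreal (- \<xi> \<omega>) * ennreal (- z \<omega>)"
        by cases (auto simp: ennreal_mult[symmetric] ennreal_neg mult_nonneg_nonpos mult_nonpos_nonneg)
    qed
    have "AE \<omega> in P. nn_cond_exp P F (\<lambda>\<omega>. ennreal (\<xi> \<omega>) * ennreal (z \<omega>)) \<omega>
        + nn_cond_exp P F (\<lambda>\<omega>. ennreal (- \<xi> \<omega>) * ennreal (- z \<omega>)) \<omega>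
        = nn_cond_exp P F (\<lambda>\<omega>. ennreal (\<xi> \<omega>) * ennreal (z \<omega>) + ennreal (- \<xi> \<omega>) * ennreal (- z \<omega>)) \<omega>"
      using \<xi>P z by (intro nn_cond_exp_sum) auto
    moreover have "AE \<omega> in P. ennreal (\<xi> \<omega>) * nn_cond_exp P F (\<lambda>\<omega>. ennreal (z \<omega>)) \<omega> =
        nn_cond_exp P F (\<lambda>\<omega>. ennreal (\<xi> \<omega>) * ennreal (z \<omega>)) \<omega>"
      using \<xi> z by (intro nn_cond_exp_prod) auto
    moreover have "AE \<omega> in P. ennreal (- \<xi> \<omega>) * nn_cond_exp P F (\<lambda>\<omega>. ennreal (- z \<omega>)) \<omega> =
        nn_cond_exp P F (\<lambda>\<omega>. ennreal (- \<xi> \<omega>) * ennreal (- z \<omega>)) \<omega>"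
      using \<xi> z by (intro nn_cond_exp_prod) auto
    ultimately show ?thesis unfolding eq by eventually_elim simp
  qed
  from *[OF y] *[of "\<lambda>\<omega>. - y \<omega>", OF borel_measurable_uminus[OF y]] show ?thesis
    unfolding real_cond_exp_def
  proof eventually_elim
    case (elim \<omega>)
    show ?case
    proof (cases "\<xi> \<omega> \<ge> 0")
      case True
      then show ?thesis using elim by (simp add: ennreal_neg enn2real_mult algebra_simps)
    next
      case False
      then show ?thesis using elim by (simp add: ennreal_neg enn2real_mult algebra_simps)
    qed
  qed
qed

lemma L1_cond_iff:
  "y \<in> L1_cond P F \<longleftrightarrow> y \<in> borel_measurable P \<and>
     (AE \<omega> in P. nn_cond_exp P F (\<lambda>\<omega>. ennreal \<bar>y \<omega>\<bar>) \<omega> < \<infinity>)"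
  by (simp add: L1_cond_def cond_norm1_def)

lemma L1_cond_measurable: "y \<in> L1_cond P F \<Longrightarrow> y \<in> borel_measurable P"
  by (simp add: L1_cond_iff)

text \<open>The F-measurable factor leaves the conditional expectation, and a finite multiple of a
  finite value is finite. This yields the module structure of \<open>L1_cond\<close> over
  F-measurable functions and its closure under multiplication by \<open>Linf_cond\<close>.\<close>

lemma L1_cond_dominated:
  assumes y: "y \<in> L1_cond P F" and z: "z \<in> borel_measurable P" and \<xi>: "\<xi> \<in> borel_measurable F"
    and le: "AE \<omega> in P. \<bar>z \<omega>\<bar> \<le> \<xi> \<omega> * \<bar>y \<omega>\<bar>"
  shows "z \<in> L1_cond P F"
proof -
  note [measurable] = z L1_cond_measurable[OF y] measurable_F[OF \<xi>]
  have "AE \<omega> in P. nn_cond_exp P F (\<lambda>\<omega>. ennreal \<bar>z \<omega>\<bar>) \<omega>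
      \<le> nn_cond_exp P F (\<lambda>\<omega>. ennreal \<bar>\<xi> \<omega>\<bar> * ennreal \<bar>y \<omega>\<bar>) \<omega>"
  proof (rule nn_cond_exp_mono)
    show "AE \<omega> in P. ennreal \<bar>z \<omega>\<bar> \<le> ennreal \<bar>\<xi> \<omega>\<bar> * ennreal \<bar>y \<omega>\<bar>"
      using le
    proof eventually_elim
      case (elim \<omega>)
      have "\<xi> \<omega> * \<bar>y \<omega>\<bar> \<le> \<bar>\<xi> \<omega>\<bar> * \<bar>y \<omega>\<bar>" by (intro mult_right_mono) auto
      then show ?case using elim by (simp add: ennreal_mult[symmetric] ennreal_leI)
    qed
  qed auto
  moreover have "AE \<omega> in P. ennreal \<bar>\<xi> \<omega>\<bar> * nn_cond_exp P F (\<lambda>\<omega>. ennreal \<bar>y \<omega>\<bar>) \<omega> =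
        nn_cond_exp P F (\<lambda>\<omega>. ennreal \<bar>\<xi> \<omega>\<bar> * ennreal \<bar>y \<omega>\<bar>) \<omega>"
    using \<xi> by (intro nn_cond_exp_prod) auto
  moreover have "AE \<omega> in P. nn_cond_exp P F (\<lambda>\<omega>. ennreal \<bar>y \<omega>\<bar>) \<omega> < \<infinity>"
    using y by (simp add: L1_cond_iff)
  ultimately have "AE \<omega> in P. nn_cond_exp P F (\<lambda>\<omega>. ennreal \<bar>z \<omega>\<bar>) \<omega> < \<infinity>"
    by eventually_elim (metis ennreal_less_top ennreal_mult_less_top infinity_ennreal_def le_less_trans)
  then show ?thesis by (simp add: L1_cond_iff)
qed

lemma L1_cond_add:
  assumes y: "y \<in> L1_cond P F" and z: "z \<in> L1_cond P F"
  shows "(\<lambda>\<omega>. y \<omega> + z \<omega>) \<in> L1_cond P F"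
proof -
  note [measurable] = L1_cond_measurable[OF y] L1_cond_measurable[OF z]
  have "AE \<omega> in P. nn_cond_exp P F (\<lambda>\<omega>. ennreal \<bar>y \<omega> + z \<omega>\<bar>) \<omega>
      \<le> nn_cond_exp P F (\<lambda>\<omega>. ennreal \<bar>y \<omega>\<bar> + ennreal \<bar>z \<omega>\<bar>) \<omega>"
    by (intro nn_cond_exp_mono) (auto simp: ennreal_plus[symmetric] simp del: ennreal_plus intro!: ennreal_leI)
  moreover have "AE \<omega> in P. nn_cond_exp P F (\<lambda>\<omega>. ennreal \<bar>y \<omega>\<bar>) \<omega> + nn_cond_exp P F (\<lambda>\<omega>. ennreal \<bar>z \<omega>\<bar>) \<omega>
      = nn_cond_exp P F (\<lambda>\<omega>. ennreal \<bar>y \<omega>\<bar> + ennreal \<bar>z \<omega>\<bar>) \<omega>"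
    by (intro nn_cond_exp_sum) auto
  moreover have "AE \<omega> in P. nn_cond_exp P F (\<lambda>\<omega>. ennreal \<bar>y \<omega>\<bar>) \<omega> < \<infinity>"
    "AE \<omega> in P. nn_cond_exp P F (\<lambda>\<omega>. ennreal \<bar>z \<omega>\<bar>) \<omega> < \<infinity>"
    using y z by (simp_all add: L1_cond_iff)
  ultimately have "AE \<omega> in P. nn_cond_exp P F (\<lambda>\<omega>. ennreal \<bar>y \<omega> + z \<omega>\<bar>) \<omega> < \<infinity>"
    by eventually_elim (metis ennreal_add_less_top infinity_ennreal_def le_less_trans)
  then show ?thesis by (simp add: L1_cond_iff)
qed

lemma L1_cond_nn_cond_exp_finite:
  assumes y: "y \<in> L1_cond P F"
  shows "AE \<omega> in P. nn_cond_exp P F (\<lambda>\<omega>. ennreal (y \<omega>)) \<omega> < \<infinity>"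
    and "AE \<omega> in P. nn_cond_exp P F (\<lambda>\<omega>. ennreal (- y \<omega>)) \<omega> < \<infinity>"
proof -
  note [measurable] = L1_cond_measurable[OF y]
  have fin: "AE \<omega> in P. nn_cond_exp P F (\<lambda>\<omega>. ennreal \<bar>y \<omega>\<bar>) \<omega> < \<infinity>"
    using y by (simp add: L1_cond_iff)
  have "AE \<omega> in P. nn_cond_exp P F (\<lambda>\<omega>. ennreal (y \<omega>)) \<omega> \<le> nn_cond_exp P F (\<lambda>\<omega>. ennreal \<bar>y \<omega>\<bar>) \<omega>"
    "AE \<omega> in P. nn_cond_exp P F (\<lambda>\<omega>. ennreal (- y \<omega>)) \<omega> \<le> nn_cond_exp P F (\<lambda>\<omega>. ennreal \<bar>y \<omega>\<bar>) \<omega>"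
    by (intro nn_cond_exp_mono; auto intro!: ennreal_leI)+
  with fin show "AE \<omega> in P. nn_cond_exp P F (\<lambda>\<omega>. ennreal (y \<omega>)) \<omega> < \<infinity>"
    "AE \<omega> in P. nn_cond_exp P F (\<lambda>\<omega>. ennreal (- y \<omega>)) \<omega> < \<infinity>"
    by (auto elim: eventually_elim2)
qed

text \<open>With s = y + z, the identity s^+ + y^- + z^- = s^- + y^+ + z^+ has only nonnegative
  terms, so additivity of \<open>nn_cond_exp\<close> applies to both sides. Membership in
  \<open>L1_cond\<close> makes all six conditional expectations finite, and the terms can then be
  moved across.\<close>

lemma real_cond_exp_L1_add:
  assumes y: "y \<in> L1_cond P F" and z: "z \<in> L1_cond P F"
  shows "AE \<omega> in P. real_cond_exp P F (\<lambda>\<omega>. y \<omega> + z \<omega>) \<omega> = real_cond_exp P F y \<omega> + real_cond_exp P F z \<omega>"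
proof -
  note m[measurable] = L1_cond_measurable[OF y] L1_cond_measurable[OF z]
  let ?s = "\<lambda>\<omega>. y \<omega> + z \<omega>"
  let ?E = "\<lambda>h. nn_cond_exp P F (\<lambda>\<omega>. ennreal (h \<omega>))"
  let ?n = "\<lambda>h \<omega>. - h \<omega> :: real"
  have sum3: "AE \<omega> in P. nn_cond_exp P F (\<lambda>\<omega>. ennreal (a \<omega>) + ennreal (b \<omega>) + ennreal (c \<omega>)) \<omega>
      = ?E a \<omega> + ?E b \<omega> + ?E c \<omega>"
    if [measurable]: "a \<in> borel_measurable P" "b \<in> borel_measurable P" "c \<in> borel_measurable P" for a b c
  proof -
    have "AE \<omega> in P. nn_cond_exp P F (\<lambda>\<omega>. ennreal (a \<omega>) + ennreal (b \<omega>)) \<omega> + ?E c \<omega>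
      = nn_cond_exp P F (\<lambda>\<omega>. (ennreal (a \<omega>) + ennreal (b \<omega>)) + ennreal (c \<omega>)) \<omega>"
      by (intro nn_cond_exp_sum) auto
    moreover have "AE \<omega> in P. ?E a \<omega> + ?E b \<omega> = nn_cond_exp P F (\<lambda>\<omega>. ennreal (a \<omega>) + ennreal (b \<omega>)) \<omega>"
      by (intro nn_cond_exp_sum) auto
    ultimately show ?thesis by eventually_elim simp
  qed
  have eq: "(\<lambda>\<omega>. ennreal (?s \<omega>) + ennreal (- y \<omega>) + ennreal (- z \<omega>)) =
      (\<lambda>\<omega>. ennreal (- ?s \<omega>) + ennreal (y \<omega>) + ennreal (z \<omega>))"
  proof
    have e: "ennreal a + ennreal b + ennreal c = ennreal (max 0 a + max 0 b + max 0 c)" for a b c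
      by (simp add: ennreal_plus[symmetric] max_def ennreal_neg del: ennreal_plus)
    show "ennreal (?s \<omega>) + ennreal (- y \<omega>) + ennreal (- z \<omega>) = ennreal (- ?s \<omega>) + ennreal (y \<omega>) + ennreal (z \<omega>)" for \<omega>
      unfolding e by (rule arg_cong[where f = ennreal]) (auto simp: max_def)
  qed
  have "AE \<omega> in P. ?E ?s \<omega> + ?E (?n y) \<omega> + ?E (?n z) \<omega> = ?E (?n ?s) \<omega> + ?E y \<omega> + ?E z \<omega>"
    using sum3[of ?s "?n y" "?n z"] sum3[of "?n ?s" y z] unfolding eq by auto
  then show ?thesis
    using L1_cond_nn_cond_exp_finite[OF y] L1_cond_nn_cond_exp_finite[OF z]
      L1_cond_nn_cond_exp_finite[OF L1_cond_add[OF y z]]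
  proof eventually_elim
    case (elim \<omega>)
    \<comment> \<open>\<open>enn2real\<close> is additive on finite values only; the finiteness
      facts collected above are used here.\<close>
    have "enn2real (?E ?s \<omega> + ?E (?n y) \<omega> + ?E (?n z) \<omega>) = enn2real (?E (?n ?s) \<omega> + ?E y \<omega> + ?E z \<omega>)"
      using elim(1) by simp
    then show ?case
      using elim(2-) by (simp add: enn2real_plus real_cond_exp_def)
  qed
qed

lemma real_cond_exp_L1_sum:
  assumes "finite I" and "\<And>i. i \<in> I \<Longrightarrow> y i \<in> L1_cond P F"
  shows "(\<lambda>\<omega>. \<Sum>i\<in>I. y i \<omega>) \<in> L1_cond P F"
    and "AE \<omega> in P. real_cond_exp P F (\<lambda>\<omega>. \<Sum>i\<in>I. y i \<omega>) \<omega> = (\<Sum>i\<in>I. real_cond_exp P F (y i) \<omega>)"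
proof -
  have "(\<lambda>\<omega>. \<Sum>i\<in>I. y i \<omega>) \<in> L1_cond P F \<and>
    (AE \<omega> in P. real_cond_exp P F (\<lambda>\<omega>. \<Sum>i\<in>I. y i \<omega>) \<omega> = (\<Sum>i\<in>I. real_cond_exp P F (y i) \<omega>))"
    using assms
  proof (induction I)
    case empty
    have "(\<lambda>_. 0) \<in> L1_cond P F" using zero_in_L1_cond[OF prob_space_axioms subalg] .
    then show ?case by (auto intro!: real_cond_exp_F_meas)
  next
    case (insert i I)
    then have IH: "(\<lambda>\<omega>. \<Sum>i\<in>I. y i \<omega>) \<in> L1_cond P F"
      "AE \<omega> in P. real_cond_exp P F (\<lambda>\<omega>. \<Sum>i\<in>I. y i \<omega>) \<omega> = (\<Sum>i\<in>I. real_cond_exp P F (y i) \<omega>)"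
      and i: "y i \<in> L1_cond P F" by auto
    show ?case
      using IH(2) real_cond_exp_L1_add[OF i IH(1)] L1_cond_add[OF i IH(1)] insert.hyps by auto
  qed
  then show "(\<lambda>\<omega>. \<Sum>i\<in>I. y i \<omega>) \<in> L1_cond P F"
    "AE \<omega> in P. real_cond_exp P F (\<lambda>\<omega>. \<Sum>i\<in>I. y i \<omega>) \<omega> = (\<Sum>i\<in>I. real_cond_exp P F (y i) \<omega>)" by auto
qed

lemma L1_cond_F_mult:
  assumes "\<xi> \<in> borel_measurable F" and y: "y \<in> L1_cond P F"
  shows "(\<lambda>\<omega>. \<xi> \<omega> * y \<omega>) \<in> L1_cond P F"
  using measurable_F[OF assms(1)] L1_cond_measurable[OF y] assms(1)
  by (intro L1_cond_dominated[OF y, of _ "\<lambda>\<omega>. \<bar>\<xi> \<omega>\<bar>"]) (auto simp: abs_mult)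

lemma const_in_L1_cond: "(\<lambda>_. c) \<in> L1_cond P F"
proof -
  have "AE \<omega> in P. ennreal \<bar>c\<bar> = nn_cond_exp P F (\<lambda>_. ennreal \<bar>c\<bar>) \<omega>"
    by (rule nn_cond_exp_F_meas) auto
  then show ?thesis by (auto simp: L1_cond_iff elim!: eventually_mono)
qed

end

section \<open>Essential suprema and \<^const>\<open>Linf_cond\<close>\<close>

text \<open>Take members of \<open>S\<close> whose integrals approach the supremum of all integrals
  and form running maxima. The pointwise supremum H then has maximal integral, and a member
  exceeding H on a non-null set would raise it. The bound 1 keeps these integrals finite. Thus the
  essential supremum of a max-closed family is reached along one increasing sequence of its
  members.\<close>

lemma (in finite_measure) ex_maximizing_sequence:
  fixes S :: "('a \<Rightarrow> ennreal) set"
  assumes S: "S \<noteq> {}" "S \<subseteq> borel_measurable M"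
    and le1: "\<And>h \<omega>. h \<in> S \<Longrightarrow> h \<omega> \<le> 1"
    and max: "\<And>h k. h \<in> S \<Longrightarrow> k \<in> S \<Longrightarrow> (\<lambda>\<omega>. max (h \<omega>) (k \<omega>)) \<in> S"
  shows "\<exists>h :: nat \<Rightarrow> 'a \<Rightarrow> ennreal. range h \<subseteq> S \<and> incseq h \<and> (\<forall>k\<in>S. AE \<omega> in M. k \<omega> \<le> (SUP n. h n \<omega>))"
proof -
  let ?I = "\<lambda>h. \<integral>\<^sup>+ \<omega>. h \<omega> \<partial>M"
  obtain a :: "nat \<Rightarrow> ennreal" where a: "range a \<subseteq> ?I ` S" "(SUP h\<in>S. ?I h) = (SUP i. a i)"
    using ennreal_SUP_countable_SUP[OF S(1), of ?I] by auto
  then have "\<forall>i. \<exists>k. k \<in> S \<and> a i = ?I k" by blast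
  then obtain k where k: "\<And>i. k i \<in> S" "\<And>i. a i = ?I (k i)" by metis
  define h where "h = rec_nat (k 0) (\<lambda>n g \<omega>. max (g \<omega>) (k (Suc n) \<omega>))"
  have h_simps: "h 0 = k 0" "h (Suc n) = (\<lambda>\<omega>. max (h n \<omega>) (k (Suc n) \<omega>))" for n
    by (simp_all add: h_def)
  have hS: "h n \<in> S" for n
    by (induction n) (auto simp: h_simps intro: k(1) max)
  have inc: "incseq h" by (rule incseq_SucI) (auto simp: h_simps le_fun_def)
  have kh: "k n \<le> h n" for n by (cases n) (auto simp: h_simps le_fun_def)
  let ?H = "\<lambda>\<omega>. SUP n. h n \<omega>"
  have meas: "z \<in> borel_measurable M" if "z \<in> S" for z using that S by auto
  have H: "?H \<in> borel_measurable M" using hS meas by (intro borel_measurable_SUP) auto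
  have "?H \<omega> \<le> 1" for \<omega> using le1 hS by (auto intro: SUP_least)
  then have "?I ?H \<le> (\<integral>\<^sup>+ \<omega>. 1 \<partial>M)" by (intro nn_integral_mono) auto
  then have fin: "?I ?H \<noteq> \<infinity>" by (auto simp: top_unique)
  have "AE \<omega> in M. z \<omega> \<le> ?H \<omega>" if z: "z \<in> S" for z
  proof -
    \<comment> \<open>The maximum of \<open>z\<close> and H is the increasing limit of the functions
      max(z, h n), which lie in \<open>S\<close>; so its integral cannot exceed the supremum, which
      is the integral of H.\<close>
    let ?Z = "\<lambda>\<omega>. max (z \<omega>) (?H \<omega>)"
    have "?Z = (\<lambda>\<omega>. SUP n. max (z \<omega>) (h n \<omega>))"
      by (rule ext) (simp add: SUP_sup_distrib[symmetric] flip: sup_max)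
    then have "?I ?Z = (\<integral>\<^sup>+ \<omega>. (SUP n. max (z \<omega>) (h n \<omega>)) \<partial>M)" by simp
    also have "\<dots> = (SUP n. ?I (\<lambda>\<omega>. max (z \<omega>) (h n \<omega>)))"
      using inc meas[OF hS] meas[OF z]
      by (intro nn_integral_monotone_convergence_SUP)
         (auto simp: incseq_def le_fun_def max.coboundedI2)
    also have "\<dots> \<le> (SUP h\<in>S. ?I h)"
      using max[OF z hS] by (intro SUP_least SUP_upper2[OF _ order_refl]) auto
    also have "\<dots> \<le> ?I ?H" unfolding a(2) k(2)
    proof (intro SUP_least nn_integral_mono)
      fix i \<omega>
      have "k i \<omega> \<le> h i \<omega>" using kh by (simp add: le_fun_def)
      also have "\<dots> \<le> ?H \<omega>" by (rule SUP_upper) simp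
      finally show "k i \<omega> \<le> ?H \<omega>" .
    qed
    finally have le: "?I ?Z \<le> ?I ?H" .
    have "(\<integral>\<^sup>+ \<omega>. ?Z \<omega> - ?H \<omega> \<partial>M) = ?I ?Z - ?I ?H"
      using H meas[OF z] fin by (intro nn_integral_diff) auto
    also have "\<dots> = 0" using le fin by (simp add: diff_eq_0_iff_ennreal less_top)
    finally have "AE \<omega> in M. ?Z \<omega> - ?H \<omega> = 0"
      using H meas[OF z] by (subst (asm) nn_integral_0_iff_AE) auto
    then show ?thesis
    proof eventually_elim
      case (elim \<omega>)
      have "?H \<omega> \<noteq> top" using \<open>?H \<omega> \<le> 1\<close> by (metis ennreal_one_less_top leD)
      then show ?case using elim by (auto simp: diff_eq_0_iff_ennreal less_top)
    qed
  qed
  then show ?thesis using hS inc by blast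
qed

text \<open>The map t to 1/(1+t) embeds [0, infinity] into [0, 1] with reversed order. It turns the
  minimisation problems below into the bounded maximisation of
  \<open>ex_maximizing_sequence\<close>.\<close>

lemma inverse_one_add_le_iff:
  fixes a b :: ennreal
  shows "inverse (1 + a) \<le> inverse (1 + b) \<longleftrightarrow> b \<le> a"
proof -
  have r: "inverse (1 + ennreal r) = ennreal (1 / (1 + r))" if "r \<ge> 0" for r
    using that inverse_ennreal[of "1 + r"] by (simp add: divide_inverse)
  have p: "1 / (1 + r) > 0" if "r \<ge> 0" for r :: real using that by simp
  show ?thesis
    by (cases a; cases b)
       (auto simp: r p ennreal_le_iff not_le[symmetric] top_unique divide_le_eq_1 frac_le field_simps)
qed

lemma is_ess_Sup_upper: "is_ess_Sup P F S g \<Longrightarrow> h \<in> S \<Longrightarrow> AE \<omega> in P. h \<omega> \<le> g \<omega>"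
  by (simp add: is_ess_Sup_def)

lemma is_ess_Sup_least:
  "is_ess_Sup P F S g \<Longrightarrow> u \<in> borel_measurable F \<Longrightarrow> (\<And>h. h \<in> S \<Longrightarrow> AE \<omega> in P. h \<omega> \<le> u \<omega>) \<Longrightarrow>
    AE \<omega> in P. g \<omega> \<le> u \<omega>"
  by (simp add: is_ess_Sup_def)

lemma is_ess_Inf_lower: "is_ess_Inf P F S g \<Longrightarrow> h \<in> S \<Longrightarrow> AE \<omega> in P. g \<omega> \<le> h \<omega>"
  by (simp add: is_ess_Inf_def)

lemma is_ess_Inf_greatest:
  "is_ess_Inf P F S g \<Longrightarrow> u \<in> borel_measurable F \<Longrightarrow> (\<And>h. h \<in> S \<Longrightarrow> AE \<omega> in P. u \<omega> \<le> h \<omega>) \<Longrightarrow>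
    AE \<omega> in P. u \<omega> \<le> g \<omega>"
  by (simp add: is_ess_Inf_def)

section \<open>Describing \<open>Linf_cond\<close> by F-measurable bounds\<close>

context cond_prob_space
begin

lemma is_ess_Sup_ess_Sup: "S \<subseteq> borel_measurable F \<Longrightarrow> is_ess_Sup P F S (ess_Sup P F S)"
  unfolding ess_Sup_def using is_ess_Sup_exists[OF prob_space_axioms subalg] by (rule someI_ex)

lemma is_ess_Inf_ess_Inf: "S \<subseteq> borel_measurable F \<Longrightarrow> is_ess_Inf P F S (ess_Inf P F S)"
  unfolding ess_Inf_def using is_ess_Inf_exists[OF prob_space_axioms subalg] by (rule someI_ex)

text \<open>The extended F-measurable bounds of the modulus of \<open>x\<close> are closed under
  minima, so their essential infimum is the pointwise infimum of a sequence of bounds and is itself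
  a bound. If it is finite, its real part is a real bound. From here on the lattice infimum in
  \<open>cond_norm_inf\<close> can be avoided.\<close>

lemma Linf_cond_iff:
  "x \<in> Linf_cond P F \<longleftrightarrow> x \<in> borel_measurable P \<and>
     (\<exists>\<xi>\<in>borel_measurable F. AE \<omega> in P. \<bar>x \<omega>\<bar> \<le> \<xi> \<omega>)"
proof
  assume x: "x \<in> Linf_cond P F"
  define S where "S = {\<xi> \<in> borel_measurable F. (AE \<omega> in P. 0 \<le> \<xi> \<omega>) \<and> (AE \<omega> in P. ereal \<bar>x \<omega>\<bar> \<le> \<xi> \<omega>)}"
  let ?i = "\<lambda>\<xi> \<omega>. inverse (1 + e2ennreal (\<xi> \<omega>))"
  have min: "(\<lambda>\<omega>. min (\<xi> \<omega>) (\<eta> \<omega>)) \<in> S" if "\<xi> \<in> S" "\<eta> \<in> S" for \<xi> \<eta>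
    using that by (auto simp: S_def)
  have "\<exists>h :: nat \<Rightarrow> 'a \<Rightarrow> ennreal. range h \<subseteq> ?i ` S \<and> incseq h \<and>
      (\<forall>k\<in>?i ` S. AE \<omega> in P. k \<omega> \<le> (SUP n. h n \<omega>))"
  proof (rule ex_maximizing_sequence)
    have "(\<lambda>_. \<infinity>) \<in> S" by (auto simp: S_def)
    then show "?i ` S \<noteq> {}" by blast
    show "?i ` S \<subseteq> borel_measurable P" by (auto simp: S_def intro!: borel_measurable_inverse_ennreal dest: measurable_F)
    have "inverse (1 + a) \<le> 1" for a :: ennreal
      using inverse_one_add_le_iff[of a 0] by simp
    then show "h \<omega> \<le> 1" if "h \<in> ?i ` S" for h \<omega> using that by auto
    show "(\<lambda>\<omega>. max (h \<omega>) (k \<omega>)) \<in> ?i ` S" if "h \<in> ?i ` S" "k \<in> ?i ` S" for h k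
    proof -
      from that obtain \<xi> \<eta> where *: "\<xi> \<in> S" "h = ?i \<xi>" "\<eta> \<in> S" "k = ?i \<eta>" by blast
      have "max (?i \<xi> \<omega>) (?i \<eta> \<omega>) = ?i (\<lambda>\<omega>. min (\<xi> \<omega>) (\<eta> \<omega>)) \<omega>" for \<omega>
      proof (cases "\<xi> \<omega> \<le> \<eta> \<omega>")
        case True
        then have "e2ennreal (\<xi> \<omega>) \<le> e2ennreal (\<eta> \<omega>)" by (rule e2ennreal_mono)
        then show ?thesis using True by (simp add: min_def max_absorb1 inverse_one_add_le_iff)
      next
        case False
        then have "e2ennreal (\<eta> \<omega>) \<le> e2ennreal (\<xi> \<omega>)" by (intro e2ennreal_mono) auto
        then show ?thesis using False by (simp add: min_def max_absorb2 inverse_one_add_le_iff)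
      qed
      then show ?thesis using min[OF *(1,3)] unfolding *(2,4) by (intro image_eqI[rotated]) auto
    qed
  qed
  then obtain h :: "nat \<Rightarrow> 'a \<Rightarrow> ennreal" where h: "range h \<subseteq> ?i ` S"
    "\<forall>k\<in>?i ` S. AE \<omega> in P. k \<omega> \<le> (SUP n. h n \<omega>)"
    by (elim exE conjE) (rule that)
  have "\<forall>n. \<exists>\<xi>. \<xi> \<in> S \<and> h n = ?i \<xi>"
  proof
    fix n
    have "h n \<in> ?i ` S" using h(1) by (rule range_subsetD)
    then show "\<exists>\<xi>. \<xi> \<in> S \<and> h n = ?i \<xi>" by (rule imageE) blast
  qed
  from choice[OF this] obtain X where X: "\<And>n. X n \<in> S" "\<And>n. h n = ?i (X n)" by blast
  \<comment> \<open>Only countably many bounds enter, so the exceptional null sets unite to a null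
    set and \<open>G\<close> still dominates the modulus of \<open>x\<close> almost surely.\<close>
  define G where "G = (\<lambda>\<omega>. INF n. X n \<omega>)"
  have G: "G \<in> borel_measurable F" unfolding G_def using X(1) by (intro borel_measurable_INF) (auto simp: S_def)
  have "AE \<omega> in P. \<forall>n. 0 \<le> X n \<omega>" "AE \<omega> in P. \<forall>n. ereal \<bar>x \<omega>\<bar> \<le> X n \<omega>"
    using X(1) by (auto simp: S_def AE_all_countable)
  then have G0: "AE \<omega> in P. 0 \<le> G \<omega>" and xG: "AE \<omega> in P. ereal \<bar>x \<omega>\<bar> \<le> G \<omega>"
    unfolding G_def by (eventually_elim, auto intro: INF_greatest)+
  have lower: "AE \<omega> in P. G \<omega> \<le> \<xi> \<omega>" if \<xi>: "\<xi> \<in> S" for \<xi>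
  proof -
    have "AE \<omega> in P. ?i \<xi> \<omega> \<le> (SUP n. h n \<omega>)" using \<xi> by (intro bspec[OF h(2)] imageI)
    moreover have "AE \<omega> in P. 0 \<le> \<xi> \<omega>" using \<xi> by (simp add: S_def)
    ultimately show ?thesis using G0
    proof eventually_elim
      case (elim \<omega>)
      have "(SUP n. h n \<omega>) \<le> ?i G \<omega>"
        unfolding X(2) inverse_one_add_le_iff G_def
        by (intro SUP_least) (auto simp: inverse_one_add_le_iff intro!: e2ennreal_mono INF_lower)
      then have "?i \<xi> \<omega> \<le> ?i G \<omega>" using elim(1) by (rule order_trans[rotated])
      then have "e2ennreal (G \<omega>) \<le> e2ennreal (\<xi> \<omega>)" by (simp add: inverse_one_add_le_iff)
      then have "enn2ereal (e2ennreal (G \<omega>)) \<le> enn2ereal (e2ennreal (\<xi> \<omega>))"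
        by (simp add: less_eq_ennreal.rep_eq)
      then show ?case using elim by (simp add: enn2ereal_e2ennreal)
    qed
  qed
  have "is_ess_Inf P F S (cond_norm_inf P F x)"
    unfolding cond_norm_inf_def S_def by (rule is_ess_Inf_ess_Inf) auto
  then have "AE \<omega> in P. G \<omega> \<le> cond_norm_inf P F x \<omega>"
    using G lower by (rule is_ess_Inf_greatest)
  moreover have "AE \<omega> in P. cond_norm_inf P F x \<omega> < \<infinity>"
    using x unfolding Linf_cond_def by (auto elim: eventually_mono)
  \<comment> \<open>\<open>G\<close> lies below the finite conditional norm and above a nonnegative
    real, so \<open>real_of_ereal\<close> does not change it almost surely.\<close>
  ultimately have "AE \<omega> in P. \<bar>x \<omega>\<bar> \<le> real_of_ereal (G \<omega>)"
    using xG
  proof eventually_elim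
    case (elim \<omega>)
    then show ?case by (cases "G \<omega>") auto
  qed
  then show "x \<in> borel_measurable P \<and> (\<exists>\<xi>\<in>borel_measurable F. AE \<omega> in P. \<bar>x \<omega>\<bar> \<le> \<xi> \<omega>)"
    using x G unfolding Linf_cond_def
    by (intro conjI bexI[of _ "\<lambda>\<omega>. real_of_ereal (G \<omega>)"]) auto
next
  let ?S = "{\<xi> \<in> borel_measurable F. (AE \<omega> in P. 0 \<le> \<xi> \<omega>) \<and> (AE \<omega> in P. ereal \<bar>x \<omega>\<bar> \<le> \<xi> \<omega>)}"
  assume "x \<in> borel_measurable P \<and> (\<exists>\<xi>\<in>borel_measurable F. AE \<omega> in P. \<bar>x \<omega>\<bar> \<le> \<xi> \<omega>)"
  then obtain \<xi> where x: "x \<in> borel_measurable P" and \<xi>: "\<xi> \<in> borel_measurable F"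
    "AE \<omega> in P. \<bar>x \<omega>\<bar> \<le> \<xi> \<omega>" by blast
  have *: "is_ess_Inf P F ?S (cond_norm_inf P F x)"
    unfolding cond_norm_inf_def by (rule is_ess_Inf_ess_Inf) auto
  have "AE \<omega> in P. 0 \<le> cond_norm_inf P F x \<omega>"
    by (rule is_ess_Inf_greatest[OF *]) auto
  moreover have "AE \<omega> in P. 0 \<le> ereal (\<xi> \<omega>)" "AE \<omega> in P. ereal \<bar>x \<omega>\<bar> \<le> ereal (\<xi> \<omega>)"
    using \<xi>(2) by (eventually_elim, simp)+
  then have "AE \<omega> in P. cond_norm_inf P F x \<omega> \<le> ereal (\<xi> \<omega>)"
    using \<xi>(1) by (intro is_ess_Inf_lower[OF *]) simp
  ultimately have "AE \<omega> in P. 0 \<le> cond_norm_inf P F x \<omega> \<and> cond_norm_inf P F x \<omega> < \<infinity>"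
    by eventually_elim (auto simp: le_less_trans)
  then show "x \<in> Linf_cond P F" using x by (simp add: Linf_cond_def)
qed

lemma Linf_cond_measurable: "x \<in> Linf_cond P F \<Longrightarrow> x \<in> borel_measurable P"
  by (simp add: Linf_cond_iff)

lemma F_in_Linf_cond: "r \<in> borel_measurable F \<Longrightarrow> r \<in> Linf_cond P F"
  unfolding Linf_cond_iff by (auto intro!: measurable_F bexI[of _ "\<lambda>\<omega>. \<bar>r \<omega>\<bar>"])

lemma Linf_cond_add:
  assumes "x \<in> Linf_cond P F" "z \<in> Linf_cond P F"
  shows "(\<lambda>\<omega>. x \<omega> + z \<omega>) \<in> Linf_cond P F"
proof -
  from assms obtain \<xi> \<eta> where *: "x \<in> borel_measurable P" "z \<in> borel_measurable P"
    "\<xi> \<in> borel_measurable F" "\<eta> \<in> borel_measurable F" "AE \<omega> in P. \<bar>x \<omega>\<bar> \<le> \<xi> \<omega>" "AE \<omega> in P. \<bar>z \<omega>\<bar> \<le> \<eta> \<omega>"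
    unfolding Linf_cond_iff by blast
  have "AE \<omega> in P. \<bar>x \<omega> + z \<omega>\<bar> \<le> \<xi> \<omega> + \<eta> \<omega>" using *(5,6) by eventually_elim auto
  then show ?thesis using * unfolding Linf_cond_iff
    by (intro conjI bexI[of _ "\<lambda>\<omega>. \<xi> \<omega> + \<eta> \<omega>"]) auto
qed

lemma Linf_cond_mult:
  assumes "x \<in> Linf_cond P F" "z \<in> Linf_cond P F"
  shows "(\<lambda>\<omega>. x \<omega> * z \<omega>) \<in> Linf_cond P F"
proof -
  from assms obtain \<xi> \<eta> where *: "x \<in> borel_measurable P" "z \<in> borel_measurable P"
    "\<xi> \<in> borel_measurable F" "\<eta> \<in> borel_measurable F" "AE \<omega> in P. \<bar>x \<omega>\<bar> \<le> \<xi> \<omega>" "AE \<omega> in P. \<bar>z \<omega>\<bar> \<le> \<eta> \<omega>"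
    unfolding Linf_cond_iff by blast
  have "AE \<omega> in P. \<bar>x \<omega> * z \<omega>\<bar> \<le> \<xi> \<omega> * \<eta> \<omega>"
    using *(5,6) by eventually_elim (auto simp: abs_mult intro: mult_mono)
  then show ?thesis using * unfolding Linf_cond_iff
    by (intro conjI bexI[of _ "\<lambda>\<omega>. \<xi> \<omega> * \<eta> \<omega>"]) auto
qed

lemma Linf_cond_diff:
  assumes "x \<in> Linf_cond P F" "z \<in> Linf_cond P F"
  shows "(\<lambda>\<omega>. x \<omega> - z \<omega>) \<in> Linf_cond P F"
  using Linf_cond_add[OF assms(1) Linf_cond_mult[OF F_in_Linf_cond[of "\<lambda>_. -1"] assms(2)]] by simp

text \<open>The index \<open>N\<close> encodes a countable F-measurable partition into the events
  where \<open>N\<close> equals n; the F-measurable bounds are glued along the same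
  partition.\<close>

lemma Linf_cond_glue:
  assumes X: "\<And>n::nat. X n \<in> Linf_cond P F" and N: "N \<in> measurable F (count_space UNIV)"
  shows "(\<lambda>\<omega>. X (N \<omega>) \<omega>) \<in> Linf_cond P F"
proof -
  from X have "\<forall>n. \<exists>\<xi>. \<xi> \<in> borel_measurable F \<and> (AE \<omega> in P. \<bar>X n \<omega>\<bar> \<le> \<xi> \<omega>)"
    unfolding Linf_cond_iff by blast
  then obtain \<xi> where \<xi>: "\<And>n. \<xi> n \<in> borel_measurable F" "\<And>n. AE \<omega> in P. \<bar>X n \<omega>\<bar> \<le> \<xi> n \<omega>"
    by metis
  have "AE \<omega> in P. \<forall>n. \<bar>X n \<omega>\<bar> \<le> \<xi> n \<omega>" using \<xi>(2) by (simp add: AE_all_countable)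
  then have "AE \<omega> in P. \<bar>X (N \<omega>) \<omega>\<bar> \<le> \<xi> (N \<omega>) \<omega>" by eventually_elim simp
  moreover have "(\<lambda>\<omega>. \<xi> (N \<omega>) \<omega>) \<in> borel_measurable F"
    using \<xi>(1) N by (rule measurable_compose_countable)
  moreover have "(\<lambda>\<omega>. X (N \<omega>) \<omega>) \<in> borel_measurable P"
    using Linf_cond_measurable[OF X] measurable_F[OF N] by (rule measurable_compose_countable)
  ultimately show ?thesis unfolding Linf_cond_iff by (intro conjI bexI)
qed

lemma L1_cond_Linf_mult:
  assumes x: "x \<in> Linf_cond P F" and y: "y \<in> L1_cond P F"
  shows "(\<lambda>\<omega>. x \<omega> * y \<omega>) \<in> L1_cond P F"
proof -
  from x obtain \<xi> where *: "x \<in> borel_measurable P" "\<xi> \<in> borel_measurable F" "AE \<omega> in P. \<bar>x \<omega>\<bar> \<le> \<xi> \<omega>"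
    unfolding Linf_cond_iff by blast
  have "AE \<omega> in P. \<bar>x \<omega> * y \<omega>\<bar> \<le> \<xi> \<omega> * \<bar>y \<omega>\<bar>"
    using *(3) by eventually_elim (auto simp: abs_mult intro: mult_right_mono)
  then show ?thesis
    using * L1_cond_measurable[OF y] by (intro L1_cond_dominated[OF y, of _ \<xi>]) auto
qed

section \<open>Linearity and locality of the conditional pairing\<close>

abbreviation pairing_bracket ("\<langle>_, _\<rangle>") where "\<langle>x, y\<rangle> \<equiv> cond_pairing P F x y"

lemma cond_pairing_measurable [measurable]: "\<langle>x, y\<rangle> \<in> borel_measurable F"
  by (simp add: cond_pairing_def)

lemma cond_pairing_add:
  assumes "x \<in> Linf_cond P F" "z \<in> Linf_cond P F" "y \<in> L1_cond P F"
  shows "AE \<omega> in P. \<langle>\<lambda>\<omega>. x \<omega> + z \<omega>, y\<rangle> \<omega> = \<langle>x, y\<rangle> \<omega> + \<langle>z, y\<rangle> \<omega>"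
  using real_cond_exp_L1_add[OF L1_cond_Linf_mult[OF assms(1,3)] L1_cond_Linf_mult[OF assms(2,3)]]
  by (simp add: cond_pairing_def algebra_simps)

lemma cond_pairing_F_mult:
  assumes "\<xi> \<in> borel_measurable F" "x \<in> Linf_cond P F" "y \<in> L1_cond P F"
  shows "AE \<omega> in P. \<langle>\<lambda>\<omega>. \<xi> \<omega> * x \<omega>, y\<rangle> \<omega> = \<xi> \<omega> * \<langle>x, y\<rangle> \<omega>"
  using real_cond_exp_F_mult[OF assms(1) L1_cond_measurable[OF L1_cond_Linf_mult[OF assms(2,3)]]]
  by (simp add: cond_pairing_def algebra_simps)

lemma cond_pairing_diff:
  assumes "x \<in> Linf_cond P F" "z \<in> Linf_cond P F" "y \<in> L1_cond P F"
  shows "AE \<omega> in P. \<langle>\<lambda>\<omega>. x \<omega> - z \<omega>, y\<rangle> \<omega> = \<langle>x, y\<rangle> \<omega> - \<langle>z, y\<rangle> \<omega>"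
  using cond_pairing_add[OF Linf_cond_diff[OF assms(1,2)] assms(2,3)]
  by eventually_elim simp

lemma cond_pairing_F:
  assumes "r \<in> borel_measurable F" "y \<in> L1_cond P F"
  shows "AE \<omega> in P. \<langle>r, y\<rangle> \<omega> = r \<omega> * real_cond_exp P F y \<omega>"
  using real_cond_exp_F_mult[OF assms(1) L1_cond_measurable[OF assms(2)]]
  by (simp add: cond_pairing_def)

text \<open>The indicator of an F-event can be moved into the conditional expectation, where it
  makes the two integrands agree, and out again.\<close>

lemma cond_pairing_local:
  assumes x: "x \<in> Linf_cond P F" and z: "z \<in> Linf_cond P F" and y: "y \<in> L1_cond P F"
    and A: "A \<in> sets F" and eq: "AE \<omega> in P. \<omega> \<in> A \<longrightarrow> x \<omega> = z \<omega>"
  shows "AE \<omega> in P. \<omega> \<in> A \<longrightarrow> \<langle>x, y\<rangle> \<omega> = \<langle>z, y\<rangle> \<omega>"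
proof -
  have i: "indicator A \<in> borel_measurable F" using A by auto
  have "AE \<omega> in P. real_cond_exp P F (\<lambda>\<omega>. indicator A \<omega> * x \<omega> * y \<omega>) \<omega> =
      real_cond_exp P F (\<lambda>\<omega>. indicator A \<omega> * z \<omega> * y \<omega>) \<omega>"
  proof (rule real_cond_exp_cong)
    show "AE \<omega> in P. indicator A \<omega> * x \<omega> * y \<omega> = indicator A \<omega> * z \<omega> * y \<omega>"
      using eq by eventually_elim (auto simp: indicator_def)
    show "(\<lambda>\<omega>. indicator A \<omega> * x \<omega> * y \<omega>) \<in> borel_measurable P"
      "(\<lambda>\<omega>. indicator A \<omega> * z \<omega> * y \<omega>) \<in> borel_measurable P"
      using sets_F[OF A] Linf_cond_measurable[OF x] Linf_cond_measurable[OF z] L1_cond_measurable[OF y]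
      by measurable
  qed
  then show ?thesis
    using cond_pairing_F_mult[OF i x y] cond_pairing_F_mult[OF i z y]
    unfolding cond_pairing_def
    by eventually_elim auto
qed

end

section \<open>Nonnegative elements with vanishing conditional expectation\<close>

context cond_prob_space
begin

text \<open>The integral of \<open>w\<close> over \<open>A\<close> equals that of its conditional
  expectation, which is 0, and a nonnegative function with zero integral vanishes. The lemma later
  gives both the sign of the separating element and the strict positivity of its conditional
  expectation.\<close>

lemma L1_cond_zero_on:
  assumes w: "w \<in> L1_cond P F" and pos: "AE \<omega> in P. 0 \<le> w \<omega>" and A: "A \<in> sets F"
    and le: "AE \<omega> in P. \<omega> \<in> A \<longrightarrow> real_cond_exp P F w \<omega> \<le> 0"
  shows "AE \<omega> in P. \<omega> \<in> A \<longrightarrow> w \<omega> = 0"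
proof -
  note [measurable] = L1_cond_measurable[OF w] A sets_F[OF A]
  have "AE \<omega> in P. nn_cond_exp P F (\<lambda>\<omega>. ennreal (- w \<omega>)) \<omega> = nn_cond_exp P F (\<lambda>_. 0) \<omega>"
    using pos by (intro nn_cond_exp_cong) (auto simp: ennreal_neg elim: eventually_mono)
  moreover have "AE \<omega> in P. (0 :: ennreal) = nn_cond_exp P F (\<lambda>_. 0) \<omega>"
    by (rule nn_cond_exp_F_meas) auto
  \<comment> \<open>Since \<open>enn2real\<close> also sends infinity to 0, finiteness is needed to
    conclude that the conditional expectation of the positive part is really 0 on
    \<open>A\<close>.\<close>
  ultimately have "AE \<omega> in P. indicator A \<omega> * nn_cond_exp P F (\<lambda>\<omega>. ennreal (w \<omega>)) \<omega> = 0"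
    using le L1_cond_nn_cond_exp_finite(1)[OF w]
  proof eventually_elim
    case (elim \<omega>)
    then show ?case
      by (cases "nn_cond_exp P F (\<lambda>\<omega>. ennreal (w \<omega>)) \<omega>")
         (auto simp: indicator_def real_cond_exp_def)
  qed
  then have "(\<integral>\<^sup>+ \<omega>. indicator A \<omega> * nn_cond_exp P F (\<lambda>\<omega>. ennreal (w \<omega>)) \<omega> \<partial>P) = 0"
    by (subst nn_integral_0_iff_AE) auto
  then have "(\<integral>\<^sup>+ \<omega>. indicator A \<omega> * ennreal (w \<omega>) \<partial>P) = 0"
    by (subst (asm) nn_cond_exp_intg) auto
  then have "AE \<omega> in P. indicator A \<omega> * ennreal (w \<omega>) = 0"
    by (subst (asm) nn_integral_0_iff_AE) auto
  then show ?thesis using pos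
    by eventually_elim (auto simp: indicator_def ennreal_eq_0_iff)
qed

end

section \<open>The acceptance set\<close>

locale convex_risk_measure = cond_prob_space P F
  for P F :: "'a measure" +
  fixes f :: "('a \<Rightarrow> real) \<Rightarrow> 'a \<Rightarrow> ereal"
  assumes risk: "cond_risk_measure P F f" and conv: "L0_convex P F f"
begin

text \<open>A real-valued version of \<open>f\<close>, so that later arithmetic takes place in the
  reals; \<open>f_eq_\<rho>\<close> shows that nothing is lost on \<open>Linf_cond\<close>.\<close>

definition \<rho> :: "('a \<Rightarrow> real) \<Rightarrow> 'a \<Rightarrow> real" where
  "\<rho> x \<omega> = real_of_ereal (f x \<omega>)"

definition acceptable :: "('a \<Rightarrow> real) set" where
  "acceptable = {x \<in> Linf_cond P F. AE \<omega> in P. \<rho> x \<omega> \<le> 0}"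

lemma f_measurable: "x \<in> Linf_cond P F \<Longrightarrow> f x \<in> borel_measurable F"
  using risk by (auto simp: cond_risk_measure_def class_function_def)

lemma \<rho>_measurable: "x \<in> Linf_cond P F \<Longrightarrow> \<rho> x \<in> borel_measurable F"
  unfolding \<rho>_def[abs_def] by (rule borel_measurable_real_of_ereal[OF f_measurable])

lemma f_cash: "x \<in> Linf_cond P F \<Longrightarrow> y \<in> borel_measurable F \<Longrightarrow>
    AE \<omega> in P. f (\<lambda>\<omega>. x \<omega> + y \<omega>) \<omega> = f x \<omega> - ereal (y \<omega>)"
  using risk by (auto simp: cond_risk_measure_def cash_invariant_def)

lemma f_antimono: "x \<in> Linf_cond P F \<Longrightarrow> z \<in> Linf_cond P F \<Longrightarrow>
    AE \<omega> in P. z \<omega> \<le> x \<omega> \<Longrightarrow> AE \<omega> in P. f x \<omega> \<le> f z \<omega>"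
  using risk by (auto simp: cond_risk_measure_def monotone_rm_def)

text \<open>Properness excludes minus infinity and provides some \<open>z\<close> with finite value.
  The difference z - x has an F-measurable bound \<xi>, so monotonicity and cash invariance give f x
  <= f (z - \<xi>) = f z + \<xi>, which is finite.\<close>

lemma f_eq_\<rho>:
  assumes x: "x \<in> Linf_cond P F"
  shows "AE \<omega> in P. f x \<omega> = ereal (\<rho> x \<omega>)"
proof -
  have "proper P F f" using risk by (simp add: cond_risk_measure_def)
  then obtain z where z: "z \<in> Linf_cond P F" "AE \<omega> in P. \<bar>f z \<omega>\<bar> < \<infinity>"
    and minf: "AE \<omega> in P. - \<infinity> < f x \<omega>"
    using x unfolding proper_def by blast
  obtain \<xi> where \<xi>: "\<xi> \<in> borel_measurable F" "AE \<omega> in P. \<bar>z \<omega> - x \<omega>\<bar> \<le> \<xi> \<omega>"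
    using Linf_cond_diff[OF z(1) x] unfolding Linf_cond_iff by blast
  have \<xi>': "(\<lambda>\<omega>. - \<xi> \<omega>) \<in> borel_measurable F" using \<xi>(1) by auto
  have "(\<lambda>\<omega>. z \<omega> + - \<xi> \<omega>) \<in> Linf_cond P F"
    by (rule Linf_cond_add[OF z(1) F_in_Linf_cond[OF \<xi>']])
  moreover have "AE \<omega> in P. z \<omega> + - \<xi> \<omega> \<le> x \<omega>" using \<xi>(2) by eventually_elim auto
  ultimately have "AE \<omega> in P. f x \<omega> \<le> f (\<lambda>\<omega>. z \<omega> + - \<xi> \<omega>) \<omega>" by (rule f_antimono[OF x])
  with f_cash[OF z(1) \<xi>'] minf z(2) show ?thesis
  proof eventually_elim
    case (elim \<omega>)
    then show ?case by (cases "f x \<omega>"; cases "f z \<omega>") (auto simp: \<rho>_def)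
  qed
qed

lemma \<rho>_cash:
  assumes "x \<in> Linf_cond P F" "y \<in> borel_measurable F"
  shows "AE \<omega> in P. \<rho> (\<lambda>\<omega>. x \<omega> + y \<omega>) \<omega> = \<rho> x \<omega> - y \<omega>"
  using f_cash[OF assms] f_eq_\<rho>[OF assms(1)]
    f_eq_\<rho>[OF Linf_cond_add[OF assms(1) F_in_Linf_cond[OF assms(2)]]]
  by eventually_elim simp

lemma \<rho>_antimono:
  assumes "x \<in> Linf_cond P F" "z \<in> Linf_cond P F" "AE \<omega> in P. z \<omega> \<le> x \<omega>"
  shows "AE \<omega> in P. \<rho> x \<omega> \<le> \<rho> z \<omega>"
  using f_antimono[OF assms] f_eq_\<rho>[OF assms(1)] f_eq_\<rho>[OF assms(2)] by eventually_elim simp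

lemma \<rho>_convex:
  assumes x: "x \<in> Linf_cond P F" and z: "z \<in> Linf_cond P F" and \<xi>: "\<xi> \<in> borel_measurable F"
    and "AE \<omega> in P. 0 \<le> \<xi> \<omega> \<and> \<xi> \<omega> \<le> 1"
  shows "AE \<omega> in P. \<rho> (\<lambda>\<omega>. \<xi> \<omega> * x \<omega> + (1 - \<xi> \<omega>) * z \<omega>) \<omega> \<le> \<xi> \<omega> * \<rho> x \<omega> + (1 - \<xi> \<omega>) * \<rho> z \<omega>"
proof -
  have \<xi>1: "(\<lambda>\<omega>. 1 - \<xi> \<omega>) \<in> borel_measurable F" using \<xi> by auto
  let ?w = "\<lambda>\<omega>. \<xi> \<omega> * x \<omega> + (1 - \<xi> \<omega>) * z \<omega>"
  have "?w \<in> Linf_cond P F"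
    by (intro Linf_cond_add Linf_cond_mult F_in_Linf_cond \<xi> \<xi>1 x z)
  then have "AE \<omega> in P. f ?w \<omega> = ereal (\<rho> ?w \<omega>)" by (rule f_eq_\<rho>)
  moreover have "AE \<omega> in P. f ?w \<omega> \<le> ereal (\<xi> \<omega>) * f x \<omega> + ereal (1 - \<xi> \<omega>) * f z \<omega>"
    using conv assms unfolding L0_convex_def by blast
  ultimately show ?thesis
    using f_eq_\<rho>[OF x] f_eq_\<rho>[OF z] by eventually_elim simp
qed

text \<open>Paste \<open>z\<close> on \<open>A\<close> with \<open>x\<close> off \<open>A\<close>:
  the result agrees with \<open>x\<close> almost surely, and convexity with weight
  \<open>indicator A\<close> bounds its value on \<open>A\<close> by that of \<open>z\<close>.
  Exchanging \<open>x\<close> and \<open>z\<close> gives equality.\<close>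

lemma \<rho>_local:
  assumes x: "x \<in> Linf_cond P F" and z: "z \<in> Linf_cond P F"
    and A: "A \<in> sets F" and eq: "AE \<omega> in P. \<omega> \<in> A \<longrightarrow> x \<omega> = z \<omega>"
  shows "AE \<omega> in P. \<omega> \<in> A \<longrightarrow> \<rho> x \<omega> = \<rho> z \<omega>"
proof -
  have le: "AE \<omega> in P. \<omega> \<in> A \<longrightarrow> \<rho> x \<omega> \<le> \<rho> z \<omega>"
    if x: "x \<in> Linf_cond P F" and z: "z \<in> Linf_cond P F"
      and eq: "AE \<omega> in P. \<omega> \<in> A \<longrightarrow> x \<omega> = z \<omega>" for x z
  proof -
    let ?w = "\<lambda>\<omega>. indicator A \<omega> * z \<omega> + (1 - indicator A \<omega>) * x \<omega>"
    have w: "?w \<in> Linf_cond P F"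
      using A by (intro Linf_cond_add Linf_cond_mult F_in_Linf_cond x z) auto
    have "AE \<omega> in P. ?w \<omega> \<le> x \<omega>" using eq by eventually_elim (auto simp: indicator_def)
    then have "AE \<omega> in P. \<rho> x \<omega> \<le> \<rho> ?w \<omega>" by (rule \<rho>_antimono[OF x w])
    moreover have "AE \<omega> in P. \<rho> ?w \<omega> \<le> indicator A \<omega> * \<rho> z \<omega> + (1 - indicator A \<omega>) * \<rho> x \<omega>"
      using A by (intro \<rho>_convex x z) (auto simp: indicator_def)
    ultimately show ?thesis by eventually_elim auto
  qed
  have "AE \<omega> in P. \<omega> \<in> A \<longrightarrow> z \<omega> = x \<omega>" using eq by eventually_elim auto
  from le[OF x z eq] le[OF z x this] show ?thesis by eventually_elim auto
qed

section \<open>Closure properties of the acceptance set\<close>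

lemma acceptable_Linf: "x \<in> acceptable \<Longrightarrow> x \<in> Linf_cond P F"
  by (simp add: acceptable_def)

text \<open>By cash invariance the shifted position has value 0. This makes the acceptance set
  nonempty and lets bounds on acceptable positions carry over to all of
  \<open>Linf_cond\<close>.\<close>

lemma acceptable_shift:
  assumes x: "x \<in> Linf_cond P F"
  shows "(\<lambda>\<omega>. x \<omega> + \<rho> x \<omega>) \<in> acceptable"
proof -
  have "AE \<omega> in P. \<rho> (\<lambda>\<omega>. x \<omega> + \<rho> x \<omega>) \<omega> \<le> 0"
    using \<rho>_cash[OF x \<rho>_measurable[OF x]] by eventually_elim simp
  then show ?thesis
    using Linf_cond_add[OF x F_in_Linf_cond[OF \<rho>_measurable[OF x]]] by (simp add: acceptable_def)
qed

lemma acceptable_mono: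
  assumes x: "x \<in> acceptable" and z: "z \<in> Linf_cond P F" and le: "AE \<omega> in P. x \<omega> \<le> z \<omega>"
  shows "z \<in> acceptable"
proof -
  have "AE \<omega> in P. \<rho> x \<omega> \<le> 0" using x by (simp add: acceptable_def)
  with \<rho>_antimono[OF z acceptable_Linf[OF x] le]
  have "AE \<omega> in P. \<rho> z \<omega> \<le> 0" by eventually_elim simp
  with z show ?thesis by (simp add: acceptable_def)
qed

lemma acceptable_convex:
  fixes t :: real
  assumes x: "x \<in> acceptable" and z: "z \<in> acceptable" and t: "0 \<le> t" "t \<le> 1"
  shows "(\<lambda>\<omega>. (1 - t) * x \<omega> + t * z \<omega>) \<in> acceptable"
proof -
  note L = acceptable_Linf[OF x] acceptable_Linf[OF z]
  have "AE \<omega> in P. \<rho> (\<lambda>\<omega>. (1 - t) * x \<omega> + (1 - (1 - t)) * z \<omega>) \<omega> \<le> (1 - t) * \<rho> x \<omega> + (1 - (1 - t)) * \<rho> z \<omega>"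
    using t by (intro \<rho>_convex L) auto
  moreover have "AE \<omega> in P. \<rho> x \<omega> \<le> 0" "AE \<omega> in P. \<rho> z \<omega> \<le> 0"
    using x z by (simp_all add: acceptable_def)
  ultimately have "AE \<omega> in P. \<rho> (\<lambda>\<omega>. (1 - t) * x \<omega> + t * z \<omega>) \<omega> \<le> 0"
  proof eventually_elim
    case (elim \<omega>)
    have "(1 - t) * \<rho> x \<omega> \<le> 0" "t * \<rho> z \<omega> \<le> 0"
      using elim t by (auto simp: mult_nonneg_nonpos)
    then show ?case using elim by simp
  qed
  moreover have "(\<lambda>\<omega>. (1 - t) * x \<omega> + t * z \<omega>) \<in> Linf_cond P F"
    by (intro Linf_cond_add Linf_cond_mult F_in_Linf_cond L) auto
  ultimately show ?thesis by (simp add: acceptable_def)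
qed

text \<open>On each event where \<open>N\<close> equals n, locality identifies the value of the
  glued function with that of \<open>X n\<close>; countably many null sets are discarded.\<close>

lemma acceptable_glue:
  assumes X: "\<And>n::nat. X n \<in> acceptable" and N: "N \<in> measurable F (count_space UNIV)"
  shows "(\<lambda>\<omega>. X (N \<omega>) \<omega>) \<in> acceptable"
proof -
  let ?x = "\<lambda>\<omega>. X (N \<omega>) \<omega>"
  have L: "?x \<in> Linf_cond P F" using acceptable_Linf[OF X] N by (rule Linf_cond_glue)
  have "AE \<omega> in P. N \<omega> = n \<longrightarrow> \<rho> ?x \<omega> \<le> 0" for n
  proof -
    have "N -` {n} \<inter> space F \<in> sets F" using N by (rule measurable_sets) auto
    then have "AE \<omega> in P. \<omega> \<in> N -` {n} \<inter> space F \<longrightarrow> \<rho> ?x \<omega> = \<rho> (X n) \<omega>"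
      by (intro \<rho>_local L acceptable_Linf X) auto
    moreover have "AE \<omega> in P. \<rho> (X n) \<omega> \<le> 0" using X by (simp add: acceptable_def)
    ultimately show ?thesis using AE_space by eventually_elim (auto simp: space_F)
  qed
  then have "AE \<omega> in P. \<forall>n. N \<omega> = n \<longrightarrow> \<rho> ?x \<omega> \<le> 0" by (subst AE_all_countable) auto
  then have "AE \<omega> in P. \<rho> ?x \<omega> \<le> 0" by eventually_elim simp
  with L show ?thesis by (simp add: acceptable_def)
qed

end

section \<open>Separation from the acceptance set\<close>

text \<open>The Hilbert space argument for minimising sequences in a convex set: midpoints cannot
  fall below the minimum \<open>D\<close>, so the parallelogram law bounds squared distances by the
  excesses over \<open>D\<close>. It is stated for real sequences, to be applied at almost every
  point.\<close>

lemma minimizing_convergent: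
  fixes U :: "nat \<Rightarrow> 'b \<Rightarrow> real"
  assumes fin: "finite Y" and lim: "(\<lambda>n. \<Sum>y\<in>Y. (U n y)\<^sup>2) \<longlonglongrightarrow> D"
    and mid: "\<And>n m. D \<le> (\<Sum>y\<in>Y. (1/2 * U n y + 1/2 * U m y)\<^sup>2)"
    and y: "y \<in> Y"
  shows "convergent (\<lambda>n. U n y)"
proof -
  let ?q = "\<lambda>n. \<Sum>y\<in>Y. (U n y)\<^sup>2"
  have le: "(U n y - U m y)\<^sup>2 \<le> 2 * (?q n - D) + 2 * (?q m - D)" for n m
  proof -
    have "(U n y - U m y)\<^sup>2 \<le> (\<Sum>y\<in>Y. (U n y - U m y)\<^sup>2)"
      using fin y by (intro member_le_sum[of y Y "\<lambda>y. (U n y - U m y)\<^sup>2"]) auto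
    \<comment> \<open>The parallelogram law, coordinate by coordinate.\<close>
    also have "\<dots> = (\<Sum>y\<in>Y. 2 * (U n y)\<^sup>2 + 2 * (U m y)\<^sup>2 - 4 * (1/2 * U n y + 1/2 * U m y)\<^sup>2)"
      by (intro sum.cong) (auto simp: power2_eq_square algebra_simps)
    also have "\<dots> = 2 * ?q n + 2 * ?q m - 4 * (\<Sum>y\<in>Y. (1/2 * U n y + 1/2 * U m y)\<^sup>2)"
      by (simp add: sum.distrib sum_subtractf sum_distrib_left)
    also have "\<dots> \<le> 2 * (?q n - D) + 2 * (?q m - D)" using mid[of n m] by simp
    finally show ?thesis .
  qed
  have "Cauchy (\<lambda>n. U n y)"
  proof (rule metric_CauchyI)
    fix e :: real assume e: "e > 0"
    then have "e\<^sup>2 / 4 > 0" by simp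
    from LIMSEQ_D[OF lim this] obtain N where N: "\<And>n. n \<ge> N \<Longrightarrow> \<bar>?q n - D\<bar> < e\<^sup>2 / 4" by auto
    have "dist (U n y) (U m y) < e" if "n \<ge> N" "m \<ge> N" for n m
    proof -
      have "?q n - D < e\<^sup>2 / 4" "?q m - D < e\<^sup>2 / 4"
        using abs_le_D1[OF less_imp_le] N[OF that(1)] N[OF that(2)] by (smt (verit))+
      then have "(U n y - U m y)\<^sup>2 < e\<^sup>2" using le[of n m] by simp
      then have "\<bar>U n y - U m y\<bar> < e" using e by (metis abs_le_square_iff abs_of_pos not_le)
      then show ?thesis by (simp add: dist_real_def)
    qed
    then show "\<exists>N. \<forall>m\<ge>N. \<forall>n\<ge>N. dist (U m y) (U n y) < e" by blast
  qed
  then show ?thesis by (rule Cauchy_convergent)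
qed

text \<open>The limit \<open>u\<close> has squared length \<open>D\<close>, and the point at
  parameter t on the segment from \<open>u\<close> to \<open>V\<close> has squared length at least
  \<open>D\<close>. Expanding, dividing by t and letting t tend to 0 gives 0 <= <u, V - u>, which is
  the claim. Only the values t = 1/(k+1) occur, so that an almost sure version needs countably many
  null sets.\<close>

lemma minimizing_variational:
  fixes U :: "nat \<Rightarrow> 'b \<Rightarrow> real"
  assumes lim: "(\<lambda>n. \<Sum>y\<in>Y. (U n y)\<^sup>2) \<longlonglongrightarrow> D"
    and u: "\<And>y. y \<in> Y \<Longrightarrow> (\<lambda>n. U n y) \<longlonglongrightarrow> u y"
    and le: "\<And>n k. D \<le> (\<Sum>y\<in>Y. ((1 - inverse (Suc k)) * U n y + inverse (Suc k) * V y)\<^sup>2)"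
  shows "D \<le> (\<Sum>y\<in>Y. u y * V y)"
proof -
  have "(\<lambda>n. \<Sum>y\<in>Y. (U n y)\<^sup>2) \<longlonglongrightarrow> (\<Sum>y\<in>Y. (u y)\<^sup>2)"
    by (intro tendsto_intros u)
  then have D: "D = (\<Sum>y\<in>Y. (u y)\<^sup>2)" using lim LIMSEQ_unique by blast
  let ?a = "\<Sum>y\<in>Y. u y * (V y - u y)" and ?b = "\<Sum>y\<in>Y. (V y - u y)\<^sup>2"
  have "0 \<le> 2 * ?a + inverse (real (Suc k)) * ?b" for k
  proof -
    let ?t = "inverse (real (Suc k))"
    have "(\<lambda>n. \<Sum>y\<in>Y. ((1 - ?t) * U n y + ?t * V y)\<^sup>2) \<longlonglongrightarrow> (\<Sum>y\<in>Y. ((1 - ?t) * u y + ?t * V y)\<^sup>2)"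
      by (intro tendsto_intros u)
    then have "D \<le> (\<Sum>y\<in>Y. ((1 - ?t) * u y + ?t * V y)\<^sup>2)"
      by (rule LIMSEQ_le_const) (use le in auto)
    also have "\<dots> = (\<Sum>y\<in>Y. (u y)\<^sup>2 + 2 * ?t * (u y * (V y - u y)) + ?t * ?t * (V y - u y)\<^sup>2)"
      by (intro sum.cong) (auto simp: power2_eq_square algebra_simps)
    also have "\<dots> = D + 2 * ?t * ?a + ?t * ?t * ?b"
      unfolding D by (simp only: sum.distrib sum_distrib_left[symmetric])
    also have "\<dots> = D + ?t * (2 * ?a + ?t * ?b)" by (simp only: distrib_left mult.assoc mult.left_commute)
    finally have "0 \<le> ?t * (2 * ?a + ?t * ?b)" by simp
    moreover have "?t > 0" by simp
    ultimately show ?thesis by (simp add: zero_le_mult_iff del: of_nat_Suc)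
  qed
  moreover have "(\<lambda>k. 2 * ?a + inverse (real (Suc k)) * ?b) \<longlonglongrightarrow> 2 * ?a + 0 * ?b"
    by (intro tendsto_intros LIMSEQ_inverse_real_of_nat)
  ultimately have "0 \<le> 2 * ?a + 0 * ?b" by (intro LIMSEQ_le_const) auto
  then show ?thesis unfolding D
    by (simp add: algebra_simps sum_subtractf power2_eq_square)
qed

section \<open>Conditional projection in finitely many coordinates\<close>

context convex_risk_measure
begin

text \<open>Pairing x - x1 with the elements of \<open>Y\<close> sends the acceptance set to a
  convex, gluing-stable family of vectors of F-measurable functions. Projecting the origin onto it
  yields a vector \<open>u\<close>; \<open>d\<close> is the squared conditional distance and
  \<open>y\<close> is the combination of \<open>Y\<close> with coefficients \<open>u\<close>.
  Separation is strict only where \<open>d\<close> is positive, an event that is merely known to be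
  non-null.\<close>

lemma acceptable_separation:
  assumes x1: "x1 \<in> Linf_cond P F" and Y: "finite Y" "Y \<subseteq> L1_cond P F"
    and \<epsilon>: "\<epsilon> \<in> borel_measurable F" "AE \<omega> in P. 0 < \<epsilon> \<omega>"
    and away: "\<And>x. x \<in> acceptable \<Longrightarrow> (\<lambda>\<omega>. x \<omega> - x1 \<omega>) \<notin> sigma_c_nbhd P F Y \<epsilon>"
  obtains y d where "y \<in> L1_cond P F" "AE \<omega> in P. 0 \<le> y \<omega>"
    "d \<in> borel_measurable F" "\<not> (AE \<omega> in P. d \<omega> \<le> 0)"
    "AE \<omega> in P. 0 < d \<omega> \<longrightarrow> 0 < real_cond_exp P F y \<omega>"
    "\<And>x. x \<in> acceptable \<Longrightarrow> AE \<omega> in P. d \<omega> \<le> \<langle>x, y\<rangle> \<omega> - \<langle>x1, y\<rangle> \<omega>"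
proof -
  \<comment> \<open>\<open>V x\<close> is the coordinate vector of x - x1, and \<open>Q x\<close> is
    its squared conditional length.\<close>
  define V where "V = (\<lambda>x y. \<langle>\<lambda>\<omega>. x \<omega> - x1 \<omega>, y\<rangle>)"
  define Q where "Q = (\<lambda>x \<omega>. \<Sum>y\<in>Y. (V x y \<omega>)\<^sup>2)"
  have V_meas: "V x y \<in> borel_measurable F" for x y by (simp add: V_def)
  have Q_meas: "Q x \<in> borel_measurable F" for x
    unfolding Q_def using V_meas by (intro borel_measurable_sum borel_measurable_power)
  have Q0: "0 \<le> Q x \<omega>" for x \<omega> by (simp add: Q_def sum_nonneg)
  have diffL: "(\<lambda>\<omega>. x \<omega> - x1 \<omega>) \<in> Linf_cond P F" if "x \<in> acceptable" for x
    using acceptable_Linf[OF that] x1 by (rule Linf_cond_diff)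
  have V_local: "AE \<omega> in P. \<omega> \<in> A \<longrightarrow> V x y \<omega> = V z y \<omega>"
    if "x \<in> acceptable" "z \<in> acceptable" "y \<in> Y" "A \<in> sets F" "\<And>\<omega>. \<omega> \<in> A \<Longrightarrow> x \<omega> = z \<omega>" for x z y A
    unfolding V_def using that Y(2) by (intro cond_pairing_local diffL) auto
  have Q_glue: "AE \<omega> in P. Q (\<lambda>\<omega>. X (N \<omega>) \<omega>) \<omega> = Q (X (N \<omega>)) \<omega>"
    if X: "\<And>n::nat. X n \<in> acceptable" and N: "N \<in> measurable F (count_space UNIV)" for X N
  proof -
    have "AE \<omega> in P. \<omega> \<in> N -` {n} \<inter> space F \<longrightarrow> V (\<lambda>\<omega>. X (N \<omega>) \<omega>) y \<omega> = V (X n) y \<omega>" if "y \<in> Y" for n y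
    proof (rule V_local[OF acceptable_glue[OF X N] X that])
      show "N -` {n} \<inter> space F \<in> sets F" using N by (rule measurable_sets) auto
    qed auto
    then have "AE \<omega> in P. \<forall>n. \<forall>y\<in>Y. \<omega> \<in> N -` {n} \<inter> space F \<longrightarrow> V (\<lambda>\<omega>. X (N \<omega>) \<omega>) y \<omega> = V (X n) y \<omega>"
      unfolding AE_all_countable AE_finite_all[OF Y(1)] by blast
    then show ?thesis
      using AE_space by eventually_elim (auto simp: Q_def space_F intro!: sum.cong)
  qed

  define i where "i = (\<lambda>t::real. inverse (1 + ennreal t))"
  \<comment> \<open>Closure under pointwise maxima is required everywhere, while gluing reproduces a
    maximum only almost surely. Hence members need only agree almost surely with some
    \<open>i (Q x)\<close>, and the bound 1 is imposed separately.\<close>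
  define S where "S = {h \<in> borel_measurable F. (\<forall>\<omega>. h \<omega> \<le> 1) \<and> (\<exists>x\<in>acceptable. AE \<omega> in P. h \<omega> = i (Q x \<omega>))}"
  have i_meas: "(\<lambda>\<omega>. i (Q x \<omega>)) \<in> borel_measurable F" for x
    unfolding i_def using Q_meas by (intro borel_measurable_inverse_ennreal) auto
  have i_le: "i s \<le> i t \<longleftrightarrow> t \<le> s" if "0 \<le> s" "0 \<le> t" for s t
    using that by (simp add: i_def inverse_one_add_le_iff)
  have i1: "i t \<le> 1" for t
    using inverse_one_add_le_iff[of "ennreal t" 0] by (simp add: i_def)
  have iQ_S: "(\<lambda>\<omega>. i (Q x \<omega>)) \<in> S" if "x \<in> acceptable" for x
    unfolding S_def using that i_meas i1 by auto
  have acc: "(\<lambda>\<omega>. x1 \<omega> + \<rho> x1 \<omega>) \<in> acceptable" using x1 by (rule acceptable_shift)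
  have "\<exists>h :: nat \<Rightarrow> 'a \<Rightarrow> ennreal. range h \<subseteq> S \<and> incseq h \<and>
      (\<forall>k\<in>S. AE \<omega> in P. k \<omega> \<le> (SUP n. h n \<omega>))"
  proof (rule ex_maximizing_sequence)
    show "S \<noteq> {}" using iQ_S[OF acc] by blast
    show "S \<subseteq> borel_measurable P" by (auto simp: S_def dest: measurable_F)
    show "h \<omega> \<le> 1" if "h \<in> S" for h \<omega> using that by (auto simp: S_def)
    show "(\<lambda>\<omega>. max (h \<omega>) (k \<omega>)) \<in> S" if h: "h \<in> S" and k: "k \<in> S" for h k
    proof -
      obtain x where x: "x \<in> acceptable" "AE \<omega> in P. h \<omega> = i (Q x \<omega>)"
        using h unfolding S_def by blast
      obtain z where z: "z \<in> acceptable" "AE \<omega> in P. k \<omega> = i (Q z \<omega>)"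
        using k unfolding S_def by blast
      have [measurable]: "h \<in> borel_measurable F" "k \<in> borel_measurable F" using h k by (auto simp: S_def)
      define X where "X = (\<lambda>n::nat. if n = 0 then x else z)"
      \<comment> \<open>At each point the glued position follows whichever of \<open>x\<close> and
        \<open>z\<close> has the larger transformed value, that is, the smaller
        \<open>Q\<close>.\<close>
      define N where "N = (\<lambda>\<omega>. if k \<omega> \<le> h \<omega> then 0 else 1::nat)"
      have N: "N \<in> measurable F (count_space UNIV)" unfolding N_def by measurable
      have X: "X n \<in> acceptable" for n using x(1) z(1) by (simp add: X_def)
      have "AE \<omega> in P. max (h \<omega>) (k \<omega>) = i (Q (\<lambda>\<omega>. X (N \<omega>) \<omega>) \<omega>)"
        using Q_glue[of X, OF X N] x(2) z(2)
        by eventually_elim (auto simp: X_def N_def max_def)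
      moreover have "(\<lambda>\<omega>. X (N \<omega>) \<omega>) \<in> acceptable" using X N by (rule acceptable_glue)
      moreover have "(\<lambda>\<omega>. max (h \<omega>) (k \<omega>)) \<in> borel_measurable F" by measurable
      moreover have "max (h \<omega>) (k \<omega>) \<le> 1" for \<omega> using h k by (auto simp: S_def)
      ultimately show ?thesis unfolding S_def by blast
    qed
  qed
  then obtain h :: "nat \<Rightarrow> 'a \<Rightarrow> ennreal" where h: "range h \<subseteq> S" "incseq h"
    "\<forall>k\<in>S. AE \<omega> in P. k \<omega> \<le> (SUP n. h n \<omega>)"
    by (elim exE conjE) (rule that)
  have "\<forall>n. \<exists>x. x \<in> acceptable \<and> (AE \<omega> in P. h n \<omega> = i (Q x \<omega>))"
    using h(1) by (auto simp: S_def)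
  from choice[OF this] obtain X where X: "\<And>n. X n \<in> acceptable"
    "\<And>n. AE \<omega> in P. h n \<omega> = i (Q (X n) \<omega>)" by blast

  \<comment> \<open>The squared conditional distance. As \<open>i\<close> reverses order,
    \<open>Q (X n)\<close> decreases to \<open>D\<close> almost surely, and \<open>D\<close> lies
    below \<open>Q x\<close> for every acceptable \<open>x\<close>.\<close>
  define D where "D = (\<lambda>\<omega>. INF n. Q (X n) \<omega>)"
  have bdd: "bdd_below (range (\<lambda>n. Q (X n) \<omega>))" for \<omega> using Q0 by (intro bdd_belowI[of _ 0]) auto
  have D_meas: "D \<in> borel_measurable F"
    unfolding D_def using Q_meas bdd by (intro borel_measurable_cINF) auto
  have D0: "0 \<le> D \<omega>" for \<omega> unfolding D_def by (intro cINF_greatest Q0) auto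
  have D_lim: "AE \<omega> in P. (\<lambda>n. Q (X n) \<omega>) \<longlonglongrightarrow> D \<omega>"
  proof -
    have "AE \<omega> in P. \<forall>n. h n \<omega> = i (Q (X n) \<omega>)" using X(2) by (simp add: AE_all_countable)
    then show ?thesis
    proof eventually_elim
      case (elim \<omega>)
      have "decseq (\<lambda>n. Q (X n) \<omega>)"
      proof (rule decseq_SucI)
        fix n
        have "h n \<omega> \<le> h (Suc n) \<omega>" using h(2) by (simp add: incseq_Suc_iff le_fun_def)
        then show "Q (X (Suc n)) \<omega> \<le> Q (X n) \<omega>" using elim by (simp add: i_le Q0)
      qed
      then show ?case unfolding D_def by (rule LIMSEQ_decseq_INF[OF bdd])
    qed
  qed
  have D_lower: "AE \<omega> in P. D \<omega> \<le> Q x \<omega>" if x: "x \<in> acceptable" for x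
  proof -
    have "AE \<omega> in P. i (Q x \<omega>) \<le> (SUP n. h n \<omega>)" using h(3) iQ_S[OF x] by (rule bspec)
    moreover have "AE \<omega> in P. \<forall>n. h n \<omega> = i (Q (X n) \<omega>)" using X(2) by (simp add: AE_all_countable)
    ultimately show ?thesis
    proof eventually_elim
      case (elim \<omega>)
      have "(SUP n. h n \<omega>) \<le> i (D \<omega>)"
      proof (rule SUP_least)
        fix n
        have "D \<omega> \<le> Q (X n) \<omega>" unfolding D_def using bdd by (rule cINF_lower) simp
        then show "h n \<omega> \<le> i (D \<omega>)" using elim(2) by (simp add: i_le Q0 D0)
      qed
      with elim(1) have "i (Q x \<omega>) \<le> i (D \<omega>)" by (rule order_trans)
      then show ?case by (simp add: i_le Q0 D0)
    qed
  qed
  have D_pos: "\<not> (AE \<omega> in P. D \<omega> \<le> 0)"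
  proof
    assume "AE \<omega> in P. D \<omega> \<le> 0"
    \<comment> \<open>If the distance vanished, almost every point would have a first index at which
      \<open>Q (X n)\<close> is at most the square of \<open>\<epsilon>\<close>. Gluing at that
      index produces an acceptable position inside the neighbourhood excluded by
      \<open>away\<close>.\<close>
    define N where "N = (\<lambda>\<omega>. LEAST n. Q (X n) \<omega> \<le> (\<epsilon> \<omega>)\<^sup>2)"
    have N: "N \<in> measurable F (count_space UNIV)"
      using \<epsilon>(1) Q_meas unfolding N_def by measurable
    let ?x = "\<lambda>\<omega>. X (N \<omega>) \<omega>"
    have x: "?x \<in> acceptable" using X(1) N by (rule acceptable_glue)
    have "AE \<omega> in P. Q ?x \<omega> \<le> (\<epsilon> \<omega>)\<^sup>2 \<and> 0 < \<epsilon> \<omega>"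
      using Q_glue[of X, OF X(1) N] D_lim \<open>AE \<omega> in P. D \<omega> \<le> 0\<close> \<epsilon>(2)
    proof eventually_elim
      case (elim \<omega>)
      have "D \<omega> < (\<epsilon> \<omega>)\<^sup>2" using elim(3,4) by (simp add: le_less_trans)
      with elim(2) have "eventually (\<lambda>n. Q (X n) \<omega> < (\<epsilon> \<omega>)\<^sup>2) sequentially" by (rule order_tendstoD)
      then obtain n where "Q (X n) \<omega> \<le> (\<epsilon> \<omega>)\<^sup>2" by (auto simp: eventually_sequentially intro: less_imp_le)
      then have "Q (X (N \<omega>)) \<omega> \<le> (\<epsilon> \<omega>)\<^sup>2" unfolding N_def by (rule LeastI)
      then show ?case using elim by simp
    qed
    then have "AE \<omega> in P. \<bar>V ?x y \<omega>\<bar> \<le> \<epsilon> \<omega>" if "y \<in> Y" for y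
    proof eventually_elim
      case (elim \<omega>)
      have "(V ?x y \<omega>)\<^sup>2 \<le> Q ?x \<omega>"
        unfolding Q_def using Y(1) that by (intro member_le_sum[of y Y "\<lambda>y. (V ?x y \<omega>)\<^sup>2"]) auto
      then have "(V ?x y \<omega>)\<^sup>2 \<le> (\<epsilon> \<omega>)\<^sup>2" using elim by simp
      then show ?case using elim by (simp add: abs_le_square_iff[symmetric])
    qed
    then have "(\<lambda>\<omega>. ?x \<omega> - x1 \<omega>) \<in> sigma_c_nbhd P F Y \<epsilon>"
      using diffL[OF x] by (simp add: sigma_c_nbhd_def V_def)
    with away[OF x] show False by blast
  qed

  have V_convex: "AE \<omega> in P. V (\<lambda>\<omega>. (1 - t) * x \<omega> + t * z \<omega>) y \<omega> = (1 - t) * V x y \<omega> + t * V z y \<omega>"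
    if x: "x \<in> acceptable" and z: "z \<in> acceptable" and y: "y \<in> Y" for t :: real and x z y
  proof -
    have yL: "y \<in> L1_cond P F" using y Y(2) by blast
    have c: "(\<lambda>_. 1 - t) \<in> borel_measurable F" "(\<lambda>_. t) \<in> borel_measurable F" by auto
    have eq: "(\<lambda>\<omega>. (1 - t) * x \<omega> + t * z \<omega> - x1 \<omega>) = (\<lambda>\<omega>. (1 - t) * (x \<omega> - x1 \<omega>) + t * (z \<omega> - x1 \<omega>))"
      by (simp add: algebra_simps)
    show ?thesis
      unfolding V_def eq
      using cond_pairing_add[OF Linf_cond_mult[OF F_in_Linf_cond[OF c(1)] diffL[OF x]]
          Linf_cond_mult[OF F_in_Linf_cond[OF c(2)] diffL[OF z]] yL]
        cond_pairing_F_mult[OF c(1) diffL[OF x] yL] cond_pairing_F_mult[OF c(2) diffL[OF z] yL]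
      by eventually_elim simp
  qed
  have D_convex: "AE \<omega> in P. D \<omega> \<le> (\<Sum>y\<in>Y. ((1 - t) * V x y \<omega> + t * V z y \<omega>)\<^sup>2)"
    if x: "x \<in> acceptable" and z: "z \<in> acceptable" and t: "0 \<le> t" "t \<le> 1" for t :: real and x z
  proof -
    have "AE \<omega> in P. \<forall>y\<in>Y. V (\<lambda>\<omega>. (1 - t) * x \<omega> + t * z \<omega>) y \<omega> = (1 - t) * V x y \<omega> + t * V z y \<omega>"
      using V_convex[OF x z] Y(1) by (simp add: AE_finite_all)
    with D_lower[OF acceptable_convex[OF x z t]] show ?thesis
      unfolding Q_def by eventually_elim simp
  qed
  \<comment> \<open>The coordinates of the projection. \<open>lim\<close> is defined everywhere, so
    measurability does not wait for convergence, which is shown only almost surely.\<close>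
  define u where "u = (\<lambda>y \<omega>. lim (\<lambda>n. V (X n) y \<omega>))"
  have u_meas: "u y \<in> borel_measurable F" for y
    unfolding u_def using V_meas by (intro borel_measurable_lim_metric) auto
  have u_lim: "AE \<omega> in P. \<forall>y\<in>Y. (\<lambda>n. V (X n) y \<omega>) \<longlonglongrightarrow> u y \<omega>"
  proof -
    \<comment> \<open>The case t = 1/2 of \<open>D_convex\<close> is the midpoint condition of
      \<open>minimizing_convergent\<close>, with one null set for all pairs of indices.\<close>
    have "AE \<omega> in P. \<forall>n m. D \<omega> \<le> (\<Sum>y\<in>Y. ((1 - 1/2) * V (X n) y \<omega> + 1/2 * V (X m) y \<omega>)\<^sup>2)"
      unfolding AE_all_countable by (intro allI D_convex X) auto
    with D_lim show ?thesis
    proof eventually_elim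
      case (elim \<omega>)
      have "convergent (\<lambda>n. V (X n) y \<omega>)" if "y \<in> Y" for y
        by (rule minimizing_convergent[OF Y(1) elim(1)[unfolded Q_def] _ that]) (use elim(2) in simp)
      then show ?case by (simp add: u_def convergent_LIMSEQ_iff)
    qed
  qed

  \<comment> \<open>With these F-measurable coefficients, pairing x - x1 with \<open>y\<close> gives
    the inner product of \<open>u\<close> and \<open>V x\<close>, which the variational inequality
    bounds below by \<open>D\<close>.\<close>
  define y where "y = (\<lambda>\<omega>. \<Sum>v\<in>Y. u v \<omega> * v \<omega>)"
  have uvL: "(\<lambda>\<omega>. u v \<omega> * v \<omega>) \<in> L1_cond P F" if "v \<in> Y" for v
    using u_meas that Y(2) by (intro L1_cond_F_mult) auto
  have yL: "y \<in> L1_cond P F" unfolding y_def using Y(1) uvL by (rule real_cond_exp_L1_sum(1))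
  have pair: "AE \<omega> in P. D \<omega> \<le> \<langle>x, y\<rangle> \<omega> - \<langle>x1, y\<rangle> \<omega>" if x: "x \<in> acceptable" for x
  proof -
    have "AE \<omega> in P. \<forall>n k. D \<omega> \<le> (\<Sum>y\<in>Y. ((1 - inverse (real (Suc k))) * V (X n) y \<omega> + inverse (real (Suc k)) * V x y \<omega>)\<^sup>2)"
      unfolding AE_all_countable by (intro allI D_convex X x) (auto simp: field_simps)
    with D_lim u_lim have le: "AE \<omega> in P. D \<omega> \<le> (\<Sum>v\<in>Y. u v \<omega> * V x v \<omega>)"
    proof eventually_elim
      case (elim \<omega>)
      show ?case
        by (rule minimizing_variational[OF elim(1)[unfolded Q_def]]) (use elim(2,3) in auto)
    qed
    have zL: "(\<lambda>\<omega>. u v \<omega> * ((x \<omega> - x1 \<omega>) * v \<omega>)) \<in> L1_cond P F" if "v \<in> Y" for v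
      using u_meas that Y(2) by (intro L1_cond_F_mult L1_cond_Linf_mult diffL x) auto
    have eq: "(\<lambda>\<omega>. (x \<omega> - x1 \<omega>) * y \<omega>) = (\<lambda>\<omega>. \<Sum>v\<in>Y. u v \<omega> * ((x \<omega> - x1 \<omega>) * v \<omega>))"
      by (simp add: y_def sum_distrib_left mult_ac)
    have "AE \<omega> in P. \<forall>v\<in>Y. real_cond_exp P F (\<lambda>\<omega>. u v \<omega> * ((x \<omega> - x1 \<omega>) * v \<omega>)) \<omega> = u v \<omega> * V x v \<omega>"
      unfolding V_def cond_pairing_def using Y u_meas
      by (subst AE_finite_all)
         (auto intro!: real_cond_exp_F_mult L1_cond_measurable L1_cond_Linf_mult diffL x)
    moreover have "AE \<omega> in P. real_cond_exp P F (\<lambda>\<omega>. \<Sum>v\<in>Y. u v \<omega> * ((x \<omega> - x1 \<omega>) * v \<omega>)) \<omega> =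
        (\<Sum>v\<in>Y. real_cond_exp P F (\<lambda>\<omega>. u v \<omega> * ((x \<omega> - x1 \<omega>) * v \<omega>)) \<omega>)"
      using Y(1) zL by (rule real_cond_exp_L1_sum(2))
    ultimately have "AE \<omega> in P. V x y \<omega> = (\<Sum>v\<in>Y. u v \<omega> * V x v \<omega>)"
      unfolding V_def cond_pairing_def eq by eventually_elim simp
    with le cond_pairing_diff[OF acceptable_Linf[OF x] x1 yL] show ?thesis
      unfolding V_def by eventually_elim simp
  qed
  have y0: "AE \<omega> in P. 0 \<le> y \<omega>"
  proof -
    \<comment> \<open>The indicator of the event where \<open>y\<close> is negative. Adding n times
      \<open>z\<close> to an acceptable position keeps it acceptable by monotonicity, so a negative
      pairing of \<open>z\<close> with \<open>y\<close> would violate the lower bound for large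
      n.\<close>
    define z where "z = (\<lambda>\<omega>. if y \<omega> < 0 then 1 else 0 :: real)"
    have [measurable]: "y \<in> borel_measurable P" using yL by (rule L1_cond_measurable)
    have "z \<in> borel_measurable P" unfolding z_def by measurable
    moreover have "AE \<omega> in P. \<bar>z \<omega>\<bar> \<le> 1" by (simp add: z_def)
    ultimately have zL: "z \<in> Linf_cond P F"
      unfolding Linf_cond_iff by (intro conjI bexI[of _ "\<lambda>_. 1"]) auto
    define x where "x = (\<lambda>\<omega>. x1 \<omega> + \<rho> x1 \<omega>)"
    have x: "x \<in> acceptable" using acc by (simp add: x_def)
    note xL = acceptable_Linf[OF x]
    have "AE \<omega> in P. 0 \<le> \<langle>x, y\<rangle> \<omega> - \<langle>x1, y\<rangle> \<omega> + real n * \<langle>z, y\<rangle> \<omega>" for n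
    proof -
      have c: "(\<lambda>_. real n) \<in> borel_measurable F" by auto
      have nzL: "(\<lambda>\<omega>. real n * z \<omega>) \<in> Linf_cond P F"
        by (rule Linf_cond_mult[OF F_in_Linf_cond[OF c] zL])
      have "(\<lambda>\<omega>. x \<omega> + real n * z \<omega>) \<in> acceptable"
        by (rule acceptable_mono[OF x Linf_cond_add[OF xL nzL]]) (simp add: z_def)
      from pair[OF this] cond_pairing_add[OF xL nzL yL] cond_pairing_F_mult[OF c zL yL]
      show ?thesis
      proof eventually_elim
        case (elim \<omega>)
        then show ?case using D0[of \<omega>] by simp
      qed
    qed
    then have "AE \<omega> in P. \<forall>n. 0 \<le> \<langle>x, y\<rangle> \<omega> - \<langle>x1, y\<rangle> \<omega> + real n * \<langle>z, y\<rangle> \<omega>"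
      by (simp add: AE_all_countable)
    then have zy: "AE \<omega> in P. 0 \<le> \<langle>z, y\<rangle> \<omega>"
    proof eventually_elim
      case (elim \<omega>)
      show ?case
      proof (rule ccontr)
        assume "\<not> 0 \<le> \<langle>z, y\<rangle> \<omega>"
        then have "0 < - \<langle>z, y\<rangle> \<omega>" by simp
        from reals_Archimedean3[OF this] obtain n
          where "\<langle>x, y\<rangle> \<omega> - \<langle>x1, y\<rangle> \<omega> < real n * - \<langle>z, y\<rangle> \<omega>" by blast
        then show False using elim[rule_format, of n] by simp
      qed
    qed
    have mz: "(\<lambda>_. -1 :: real) \<in> borel_measurable F" by auto
    have wL: "(\<lambda>\<omega>. -1 * (z \<omega> * y \<omega>)) \<in> L1_cond P F"
      by (rule L1_cond_F_mult[OF mz L1_cond_Linf_mult[OF zL yL]])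
    \<comment> \<open>The nonnegative function -zy has nonpositive conditional expectation, hence
      vanishes: \<open>y\<close> is almost surely not negative.\<close>
    have "AE \<omega> in P. \<omega> \<in> space F \<longrightarrow> -1 * (z \<omega> * y \<omega>) = 0"
    proof (rule L1_cond_zero_on[OF wL])
      show "AE \<omega> in P. 0 \<le> -1 * (z \<omega> * y \<omega>)" by (simp add: z_def)
      show "AE \<omega> in P. \<omega> \<in> space F \<longrightarrow> real_cond_exp P F (\<lambda>\<omega>. -1 * (z \<omega> * y \<omega>)) \<omega> \<le> 0"
        using zy real_cond_exp_F_mult[OF mz L1_cond_measurable[OF L1_cond_Linf_mult[OF zL yL]]]
        unfolding cond_pairing_def by eventually_elim simp
    qed simp
    then show ?thesis using AE_space
      by eventually_elim (auto simp: z_def space_F split: if_splits)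
  qed
  have Ey: "AE \<omega> in P. 0 < D \<omega> \<longrightarrow> 0 < real_cond_exp P F y \<omega>"
  proof -
    \<comment> \<open>On this event \<open>y\<close> vanishes, so all pairings with \<open>y\<close>
      are 0 there and \<open>pair\<close> forces \<open>D\<close> to be nonpositive.\<close>
    define A where "A = {\<omega> \<in> space F. real_cond_exp P F y \<omega> \<le> 0}"
    have A: "A \<in> sets F" unfolding A_def by measurable
    have yA: "AE \<omega> in P. \<omega> \<in> A \<longrightarrow> y \<omega> = 0"
      by (rule L1_cond_zero_on[OF yL y0 A]) (simp add: A_def)
    have i: "indicator A \<in> borel_measurable F" using A by auto
    have loc: "AE \<omega> in P. \<omega> \<in> A \<longrightarrow> \<langle>x, y\<rangle> \<omega> = 0" if x: "x \<in> Linf_cond P F" for x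
    proof -
      have "AE \<omega> in P. real_cond_exp P F (\<lambda>\<omega>. indicator A \<omega> * (x \<omega> * y \<omega>)) \<omega> = real_cond_exp P F (\<lambda>_. 0) \<omega>"
      proof (rule real_cond_exp_cong)
        show "AE \<omega> in P. indicator A \<omega> * (x \<omega> * y \<omega>) = 0"
          using yA by eventually_elim (auto simp: indicator_def)
        show "(\<lambda>\<omega>. indicator A \<omega> * (x \<omega> * y \<omega>)) \<in> borel_measurable P"
          by (rule L1_cond_measurable[OF L1_cond_F_mult[OF i L1_cond_Linf_mult[OF x yL]]])
      qed auto
      moreover have "AE \<omega> in P. real_cond_exp P F (\<lambda>_. 0) \<omega> = 0"
        by (intro real_cond_exp_F_meas) auto
      moreover note real_cond_exp_F_mult[OF i L1_cond_measurable[OF L1_cond_Linf_mult[OF x yL]]]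
      ultimately show ?thesis unfolding cond_pairing_def by eventually_elim auto
    qed
    show ?thesis
      using pair[OF acc] loc[OF acceptable_Linf[OF acc]] loc[OF x1] AE_space
      by eventually_elim (auto simp: A_def space_F)
  qed
  show thesis
    by (rule that[OF yL y0 D_meas D_pos Ey pair])
qed

end

section \<open>The two topologies\<close>

context cond_prob_space
begin

lemma openin_sigma_c:
  "openin (sigma_c P F) U \<longleftrightarrow>
     U \<subseteq> Linf_cond P F \<and> (\<forall>x\<in>U. \<exists>N\<in>sigma_c_base P F. (\<lambda>z \<omega>. x \<omega> + z \<omega>) ` N \<subseteq> U)"
  unfolding sigma_c_def
  using sigma_c_base_filter[OF prob_space_axioms subalg] by (rule openin_local_base_topology)

lemma openin_sigma_el:
  "openin (sigma_el P F) U \<longleftrightarrow>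
     U \<subseteq> Linf_cond P F \<and> (\<forall>x\<in>U. \<exists>N\<in>sigma_el_base P F. (\<lambda>z \<omega>. x \<omega> + z \<omega>) ` N \<subseteq> U)"
  unfolding sigma_el_def
  using sigma_el_base_filter[OF prob_space_axioms subalg] by (rule openin_local_base_topology)

lemma openin_prob_topology:
  "openin (prob_topology P F) U \<longleftrightarrow>
     U \<subseteq> borel_measurable F \<and> (\<forall>x\<in>U. \<exists>N\<in>prob_base P F. (\<lambda>z \<omega>. x \<omega> + z \<omega>) ` N \<subseteq> U)"
  unfolding prob_topology_def
  using prob_base_filter[OF prob_space_axioms subalg] by (rule openin_local_base_topology)

lemma topspace_sigma_c [simp]: "topspace (sigma_c P F) = Linf_cond P F"
proof (rule topspace_def[THEN trans], intro antisym Union_least Union_upper)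
  obtain N where N: "N \<in> sigma_c_base P F" using sigma_c_base_filter(1)[OF prob_space_axioms subalg] by blast
  then have "N \<subseteq> Linf_cond P F" by (auto simp: sigma_c_base_def sigma_c_nbhd_def)
  then have "(\<lambda>z \<omega>. x \<omega> + z \<omega>) ` N \<subseteq> Linf_cond P F" if "x \<in> Linf_cond P F" for x
    using Linf_cond_add[OF that] by blast
  then show "Linf_cond P F \<in> Collect (openin (sigma_c P F))"
    using N unfolding mem_Collect_eq openin_sigma_c by blast
qed (simp add: openin_sigma_c)

lemma topspace_sigma_el [simp]: "topspace (sigma_el P F) = Linf_cond P F"
proof (rule topspace_def[THEN trans], intro antisym Union_least Union_upper)
  obtain N where N: "N \<in> sigma_el_base P F" using sigma_el_base_filter(1)[OF prob_space_axioms subalg] by blast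
  then have "N \<subseteq> Linf_cond P F" by (auto simp: sigma_el_base_def sigma_el_nbhd_def)
  then have "(\<lambda>z \<omega>. x \<omega> + z \<omega>) ` N \<subseteq> Linf_cond P F" if "x \<in> Linf_cond P F" for x
    using Linf_cond_add[OF that] by blast
  then show "Linf_cond P F \<in> Collect (openin (sigma_el P F))"
    using N unfolding mem_Collect_eq openin_sigma_el by blast
qed (simp add: openin_sigma_el)

lemma topspace_prob_topology [simp]: "topspace (prob_topology P F) = borel_measurable F"
proof (rule topspace_def[THEN trans], intro antisym Union_least Union_upper)
  obtain N where N: "N \<in> prob_base P F" using prob_base_filter(1)[OF prob_space_axioms subalg] by blast
  then have "N \<subseteq> borel_measurable F" by (auto simp: prob_base_def prob_nbhd_def)
  then have "(\<lambda>z \<omega>. x \<omega> + z \<omega>) ` N \<subseteq> borel_measurable F" if "x \<in> borel_measurable F" for x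
    using that by auto
  then show "borel_measurable F \<in> Collect (openin (prob_topology P F))"
    using N unfolding mem_Collect_eq openin_prob_topology by blast
qed (simp add: openin_prob_topology)

text \<open>The event |h| < \<epsilon> is the increasing union of the events |h| < \<epsilon> -
  1/(n+1), so one of these already has probability above \<open>a\<close>. A perturbation smaller
  than 1/(n+1) outside a set of small probability keeps the estimate. The sum \<open>l\<close> is
  prescribed only almost surely because the pairing is additive only almost surely.\<close>

lemma prob_abs_less_perturb:
  fixes h :: "'a \<Rightarrow> real" and a \<epsilon> :: real
  assumes h[measurable]: "h \<in> borel_measurable P" and a: "a < prob {\<omega> \<in> space P. \<bar>h \<omega>\<bar> < \<epsilon>}"
  obtains \<epsilon>' \<delta> :: real where "0 < \<epsilon>'" "0 < \<delta>" "\<delta> < 1"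
    "\<And>k l. k \<in> borel_measurable P \<Longrightarrow> l \<in> borel_measurable P \<Longrightarrow> AE \<omega> in P. l \<omega> = h \<omega> + k \<omega> \<Longrightarrow>
      1 - \<delta> < prob {\<omega> \<in> space P. \<bar>k \<omega>\<bar> < \<epsilon>'} \<Longrightarrow>
      a < prob {\<omega> \<in> space P. \<bar>l \<omega>\<bar> < \<epsilon>}"
proof -
  let ?A = "\<lambda>n. {\<omega> \<in> space P. \<bar>h \<omega>\<bar> < \<epsilon> - inverse (real (Suc n))}"
  have "{\<omega> \<in> space P. \<bar>h \<omega>\<bar> < \<epsilon>} = (\<Union>n. ?A n)"
  proof (intro antisym subsetI)
    fix \<omega> assume \<omega>: "\<omega> \<in> {\<omega> \<in> space P. \<bar>h \<omega>\<bar> < \<epsilon>}"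
    then obtain n where "inverse (real (Suc n)) < \<epsilon> - \<bar>h \<omega>\<bar>" using reals_Archimedean[of "\<epsilon> - \<bar>h \<omega>\<bar>"] by auto
    then have "\<bar>h \<omega>\<bar> < \<epsilon> - inverse (real (Suc n))" by linarith
    with \<omega> show "\<omega> \<in> (\<Union>n. ?A n)" by blast
  next
    fix \<omega> assume "\<omega> \<in> (\<Union>n. ?A n)"
    then obtain n where "\<omega> \<in> space P" "\<bar>h \<omega>\<bar> < \<epsilon> - inverse (real (Suc n))" by blast
    moreover have "0 < inverse (real (Suc n))" by simp
    ultimately have "\<omega> \<in> space P" "\<bar>h \<omega>\<bar> < \<epsilon>" by linarith+
    then show "\<omega> \<in> {\<omega> \<in> space P. \<bar>h \<omega>\<bar> < \<epsilon>}" by simp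
  qed
  moreover have "(\<lambda>n. prob (?A n)) \<longlonglongrightarrow> prob (\<Union>n. ?A n)"
  proof (rule finite_Lim_measure_incseq)
    show "incseq ?A"
    proof (rule incseq_SucI, safe)
      fix n \<omega> assume "\<bar>h \<omega>\<bar> < \<epsilon> - inverse (real (Suc n))"
      moreover have "inverse (real (Suc (Suc n))) \<le> inverse (real (Suc n))" by simp
      ultimately show "\<bar>h \<omega>\<bar> < \<epsilon> - inverse (real (Suc (Suc n)))" by linarith
    qed
  qed auto
  ultimately have "eventually (\<lambda>n. a < prob (?A n)) sequentially"
    using a by (intro order_tendstoD) auto
  then obtain n where n: "a < prob (?A n)" by (auto simp: eventually_sequentially)
  \<comment> \<open>The room left above \<open>a\<close>; the minimum with 1/2 ensures that \<delta>
    is below 1.\<close>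
  define \<delta> where "\<delta> = min (1/2) (prob (?A n) - a)"
  show thesis
  proof (rule that)
    show "0 < inverse (real (Suc n))" by simp
    show "0 < \<delta>" "\<delta> < 1" using n by (auto simp: \<delta>_def)
    fix k l :: "'a \<Rightarrow> real"
    assume [measurable]: "k \<in> borel_measurable P" "l \<in> borel_measurable P"
      and eq: "AE \<omega> in P. l \<omega> = h \<omega> + k \<omega>"
      and k: "1 - \<delta> < prob {\<omega> \<in> space P. \<bar>k \<omega>\<bar> < inverse (real (Suc n))}" (is "_ < prob ?B")
    have "a \<le> prob (?A n) - \<delta>" by (simp add: \<delta>_def)
    also have "\<dots> < prob (?A n) + prob ?B - 1" using k by simp
    also have "\<dots> \<le> prob (?A n) + prob ?B - prob (?A n \<union> ?B)" by simp
    also have "\<dots> = prob (?A n \<inter> ?B)" by (subst measure_Un3) (auto simp: fmeasurable_eq_sets)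
    also have "\<dots> \<le> prob {\<omega> \<in> space P. \<bar>h \<omega> + k \<omega>\<bar> < \<epsilon>}"
      by (intro finite_measure_mono) (auto simp del: of_nat_Suc)
    also have "\<dots> = prob {\<omega> \<in> space P. \<bar>l \<omega>\<bar> < \<epsilon>}"
      using eq by (intro measure_eq_AE) (auto elim: eventually_mono)
    finally show "a < prob {\<omega> \<in> space P. \<bar>l \<omega>\<bar> < \<epsilon>}" .
  qed
qed

text \<open>Basic neighbourhoods are not open by definition in a topology built from a local base:
  each point of the strip needs a basic neighbourhood of its own, supplied by
  \<open>prob_abs_less_perturb\<close>.\<close>

lemma openin_sigma_el_strip:
  assumes x0: "x0 \<in> Linf_cond P F" and y: "y \<in> L1_cond P F"
  shows "openin (sigma_el P F)
    {x \<in> Linf_cond P F. a < prob {\<omega> \<in> space P. \<bar>\<langle>\<lambda>\<omega>. x \<omega> - x0 \<omega>, y\<rangle> \<omega>\<bar> < \<epsilon>}}"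
  unfolding openin_sigma_el
proof (intro conjI ballI)
  let ?U = "{x \<in> Linf_cond P F. a < prob {\<omega> \<in> space P. \<bar>\<langle>\<lambda>\<omega>. x \<omega> - x0 \<omega>, y\<rangle> \<omega>\<bar> < \<epsilon>}}"
  fix x assume x: "x \<in> ?U"
  have m: "\<langle>z, y\<rangle> \<in> borel_measurable P" for z by (rule measurable_F[OF cond_pairing_measurable])
  from x obtain \<epsilon>' \<delta> where *: "0 < \<epsilon>'" "0 < \<delta>" "\<delta> < 1"
    "\<And>k l. k \<in> borel_measurable P \<Longrightarrow> l \<in> borel_measurable P \<Longrightarrow>
      AE \<omega> in P. l \<omega> = \<langle>\<lambda>\<omega>. x \<omega> - x0 \<omega>, y\<rangle> \<omega> + k \<omega> \<Longrightarrow>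
      1 - \<delta> < prob {\<omega> \<in> space P. \<bar>k \<omega>\<bar> < \<epsilon>'} \<Longrightarrow> a < prob {\<omega> \<in> space P. \<bar>l \<omega>\<bar> < \<epsilon>}"
    using prob_abs_less_perturb[OF m] by blast
  have xL: "x \<in> Linf_cond P F" using x by simp
  have "(\<lambda>\<omega>. x \<omega> + z \<omega>) \<in> ?U" if z: "z \<in> sigma_el_nbhd P F {y} \<epsilon>' \<delta>" for z
  proof -
    have zL: "z \<in> Linf_cond P F" and zp: "1 - \<delta> < prob {\<omega> \<in> space P. \<bar>\<langle>z, y\<rangle> \<omega>\<bar> < \<epsilon>'}"
      using z by (auto simp: sigma_el_nbhd_def)
    have eq: "(\<lambda>\<omega>. x \<omega> + z \<omega> - x0 \<omega>) = (\<lambda>\<omega>. (x \<omega> - x0 \<omega>) + z \<omega>)" by auto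
    have "a < prob {\<omega> \<in> space P. \<bar>\<langle>\<lambda>\<omega>. x \<omega> + z \<omega> - x0 \<omega>, y\<rangle> \<omega>\<bar> < \<epsilon>}"
      by (rule *(4)[OF m m _ zp]) (unfold eq, rule cond_pairing_add[OF Linf_cond_diff[OF xL x0] zL y])
    then show ?thesis using Linf_cond_add[OF xL zL] by simp
  qed
  moreover have "sigma_el_nbhd P F {y} \<epsilon>' \<delta> \<in> sigma_el_base P F"
    unfolding sigma_el_base_def using * y by blast
  ultimately show "\<exists>N\<in>sigma_el_base P F. (\<lambda>z \<omega>. x \<omega> + z \<omega>) ` N \<subseteq> ?U" by blast
qed auto

lemma openin_prob_topology_strip:
  assumes r0: "r0 \<in> borel_measurable F"
  shows "openin (prob_topology P F)
    {r \<in> borel_measurable F. a < prob {\<omega> \<in> space P. \<bar>r \<omega> - r0 \<omega>\<bar> < \<epsilon>}}"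
  unfolding openin_prob_topology
proof (intro conjI ballI)
  let ?U = "{r \<in> borel_measurable F. a < prob {\<omega> \<in> space P. \<bar>r \<omega> - r0 \<omega>\<bar> < \<epsilon>}}"
  fix x assume x: "x \<in> ?U"
  have m: "(\<lambda>\<omega>. z \<omega> - r0 \<omega>) \<in> borel_measurable P" if "z \<in> borel_measurable F" for z
    using that r0 by (intro measurable_F) auto
  from x have xF: "x \<in> borel_measurable F" by simp
  from x obtain \<epsilon>' \<delta> where *: "0 < \<epsilon>'" "0 < \<delta>" "\<delta> < 1"
    "\<And>k l. k \<in> borel_measurable P \<Longrightarrow> l \<in> borel_measurable P \<Longrightarrow>
      AE \<omega> in P. l \<omega> = (x \<omega> - r0 \<omega>) + k \<omega> \<Longrightarrow>
      1 - \<delta> < prob {\<omega> \<in> space P. \<bar>k \<omega>\<bar> < \<epsilon>'} \<Longrightarrow> a < prob {\<omega> \<in> space P. \<bar>l \<omega>\<bar> < \<epsilon>}"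
    using prob_abs_less_perturb[OF m[OF xF]] by blast
  have "(\<lambda>\<omega>. x \<omega> + z \<omega>) \<in> ?U" if z: "z \<in> prob_nbhd P F \<epsilon>' \<delta>" for z
  proof -
    have zF: "z \<in> borel_measurable F" and zp: "1 - \<delta> < prob {\<omega> \<in> space P. \<bar>z \<omega>\<bar> < \<epsilon>'}"
      using z by (auto simp: prob_nbhd_def)
    have xz: "(\<lambda>\<omega>. x \<omega> + z \<omega>) \<in> borel_measurable F" using xF zF by auto
    have "a < prob {\<omega> \<in> space P. \<bar>x \<omega> + z \<omega> - r0 \<omega>\<bar> < \<epsilon>}"
      by (rule *(4)[OF measurable_F[OF zF] m[OF xz] _ zp]) auto
    then show ?thesis using xz by simp
  qed
  moreover have "prob_nbhd P F \<epsilon>' \<delta> \<in> prob_base P F"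
    unfolding prob_base_def using * by blast
  ultimately show "\<exists>N\<in>prob_base P F. (\<lambda>z \<omega>. x \<omega> + z \<omega>) ` N \<subseteq> ?U" by blast
qed auto

text \<open>A constant is an admissible F-measurable radius. Halving it turns the weak inequality of
  the one neighbourhood into the strict one of the other, which then holds with probability
  1.\<close>

lemma sigma_el_nbhd_contains_sigma_c_nbhd:
  assumes "N \<in> sigma_el_base P F"
  shows "\<exists>N'\<in>sigma_c_base P F. N' \<subseteq> N"
proof -
  from assms obtain Y \<epsilon> \<delta> where N: "N = sigma_el_nbhd P F Y \<epsilon> \<delta>" "finite Y" "Y \<noteq> {}" "Y \<subseteq> L1_cond P F"
    "0 < \<epsilon>" "0 < \<delta>" unfolding sigma_el_base_def by blast
  let ?N' = "sigma_c_nbhd P F Y (\<lambda>_. \<epsilon> / 2)"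
  have "?N' \<in> sigma_c_base P F" unfolding sigma_c_base_def
    using N by (intro CollectI exI[of _ Y] exI[of _ "\<lambda>_. \<epsilon> / 2"]) auto
  moreover have "?N' \<subseteq> N"
  proof
    fix x assume x: "x \<in> ?N'"
    then have "AE \<omega> in P. \<forall>y\<in>Y. \<bar>\<langle>x, y\<rangle> \<omega>\<bar> \<le> \<epsilon> / 2"
      using N(2) by (simp add: sigma_c_nbhd_def AE_finite_all)
    then have "AE \<omega> in P. (MAX y\<in>Y. \<bar>\<langle>x, y\<rangle> \<omega>\<bar>) < \<epsilon>"
    proof eventually_elim
      case (elim \<omega>)
      have "\<bar>\<langle>x, y\<rangle> \<omega>\<bar> < \<epsilon>" if "y \<in> Y" for y using bspec[OF elim that] N(5) by linarith
      then show ?case using N(2,3) by (simp add: Max_less_iff)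
    qed
    moreover have "{\<omega> \<in> space P. (MAX y\<in>Y. \<bar>\<langle>x, y\<rangle> \<omega>\<bar>) < \<epsilon>} \<in> events"
    proof -
      have "{\<omega> \<in> space P. (MAX y\<in>Y. \<bar>\<langle>x, y\<rangle> \<omega>\<bar>) < \<epsilon>} = {\<omega> \<in> space P. \<forall>y\<in>Y. \<bar>\<langle>x, y\<rangle> \<omega>\<bar> < \<epsilon>}"
        using N(2,3) by (simp add: Max_less_iff)
      also have "\<dots> \<in> events" unfolding cond_pairing_def using N(2) by measurable
      finally show ?thesis .
    qed
    ultimately have "measure P {\<omega> \<in> space P. (MAX y\<in>Y. \<bar>\<langle>x, y\<rangle> \<omega>\<bar>) < \<epsilon>} = 1"
      by (subst prob_Collect_eq_1)
    then show "x \<in> N" using x N(1,6) by (simp add: sigma_el_nbhd_def sigma_c_nbhd_def)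
  qed
  ultimately show ?thesis by blast
qed

text \<open>The sublevel set at \<open>r\<close> is the slice of the closed epigraph at
  \<open>r\<close>. A product neighbourhood missing the epigraph restricts to a neighbourhood in the
  first factor, and this contains a basic neighbourhood of the finer topology.\<close>

lemma lsc_sigma_el_imp_lsc_sigma_c:
  assumes "lsc_sigma_el P F f"
  shows "lsc_sigma_c P F f"
  unfolding lsc_sigma_c_def
proof
  fix r :: "'a \<Rightarrow> real" assume r: "r \<in> borel_measurable F"
  define G where "G = {(x, r). x \<in> Linf_cond P F \<and> r \<in> borel_measurable F \<and> (AE \<omega> in P. f x \<omega> \<le> ereal (r \<omega>))}"
  let ?C = "{x \<in> Linf_cond P F. AE \<omega> in P. f x \<omega> \<le> ereal (r \<omega>)}"
  have "closedin (prod_topology (sigma_el P F) (prob_topology P F)) G"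
    using assms unfolding lsc_sigma_el_def G_def .
  then have op: "openin (prod_topology (sigma_el P F) (prob_topology P F)) (Linf_cond P F \<times> borel_measurable F - G)"
    by (simp add: closedin_def)
  have "\<exists>N\<in>sigma_c_base P F. (\<lambda>z \<omega>. x \<omega> + z \<omega>) ` N \<subseteq> Linf_cond P F - ?C" if x: "x \<in> Linf_cond P F - ?C" for x
  proof -
    have "(x, r) \<in> Linf_cond P F \<times> borel_measurable F - G" using x r by (auto simp: G_def)
    then obtain U V where UV: "openin (sigma_el P F) U" "x \<in> U" "r \<in> V"
      "U \<times> V \<subseteq> Linf_cond P F \<times> borel_measurable F - G"
      using op unfolding openin_prod_topology_alt by blast
    then obtain N where N: "N \<in> sigma_el_base P F" "(\<lambda>z \<omega>. x \<omega> + z \<omega>) ` N \<subseteq> U"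
      unfolding openin_sigma_el by blast
    obtain N' where N': "N' \<in> sigma_c_base P F" "N' \<subseteq> N"
      using sigma_el_nbhd_contains_sigma_c_nbhd[OF N(1)] by blast
    have "z \<in> Linf_cond P F - ?C" if "z \<in> U" for z
    proof -
      have "(z, r) \<in> Linf_cond P F \<times> borel_measurable F - G" using UV(3,4) that by blast
      then show ?thesis by (auto simp: G_def)
    qed
    then show ?thesis using N(2) N' by (intro bexI[of _ N']) auto
  qed
  then show "closedin (sigma_c P F) ?C"
    unfolding closedin_def topspace_sigma_c openin_sigma_c by blast
qed

end

section \<open>The dual representation\<close>

context convex_risk_measure
begin

definition dual_elements :: "('a \<Rightarrow> real) set" where
  "dual_elements = {y \<in> L1_cond P F. (AE \<omega> in P. y \<omega> \<le> 0) \<and> (AE \<omega> in P. real_cond_exp P F y \<omega> = -1)}"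

definition representable :: bool where
  "representable \<longleftrightarrow> (\<forall>x\<in>Linf_cond P F. AE \<omega> in P. f x \<omega> =
     ess_Sup P F {(\<lambda>\<omega>. ereal (\<langle>x, y\<rangle> \<omega>) - cond_conjugate P F f y \<omega>) | y. y \<in> dual_elements} \<omega>)"

lemma pairing_minus_f_measurable:
  "x \<in> Linf_cond P F \<Longrightarrow> (\<lambda>\<omega>. ereal (\<langle>x, y\<rangle> \<omega>) - f x \<omega>) \<in> borel_measurable F"
  using f_measurable by (intro borel_measurable_ereal_diff borel_measurable_ereal cond_pairing_measurable) auto

lemma cond_conjugate_is_ess_Sup:
  "is_ess_Sup P F {(\<lambda>\<omega>. ereal (\<langle>x, y\<rangle> \<omega>) - f x \<omega>) | x. x \<in> Linf_cond P F} (cond_conjugate P F f y)"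
  unfolding cond_conjugate_def
  by (rule is_ess_Sup_ess_Sup) (use pairing_minus_f_measurable in blast)

lemma cond_conjugate_measurable: "cond_conjugate P F f y \<in> borel_measurable F"
  using cond_conjugate_is_ess_Sup by (simp add: is_ess_Sup_def)

text \<open>Besides the upper estimate for the supremum, this shows that the conjugate is almost
  surely not minus infinity, which rules out one case in the extended arithmetic below.\<close>

lemma fenchel_young:
  assumes x: "x \<in> Linf_cond P F"
  shows "AE \<omega> in P. ereal (\<langle>x, y\<rangle> \<omega> - \<rho> x \<omega>) \<le> cond_conjugate P F f y \<omega>"
proof -
  have "AE \<omega> in P. ereal (\<langle>x, y\<rangle> \<omega>) - f x \<omega> \<le> cond_conjugate P F f y \<omega>"
    using x by (intro is_ess_Sup_upper[OF cond_conjugate_is_ess_Sup]) blast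
  with f_eq_\<rho>[OF x] show ?thesis by eventually_elim simp
qed

lemma cond_conjugate_least:
  assumes u: "u \<in> borel_measurable F"
    and le: "\<And>x. x \<in> Linf_cond P F \<Longrightarrow> AE \<omega> in P. ereal (\<langle>x, y\<rangle> \<omega> - \<rho> x \<omega>) \<le> u \<omega>"
  shows "AE \<omega> in P. cond_conjugate P F f y \<omega> \<le> u \<omega>"
proof (rule is_ess_Sup_least[OF cond_conjugate_is_ess_Sup u])
  fix h assume "h \<in> {(\<lambda>\<omega>. ereal (\<langle>x, y\<rangle> \<omega>) - f x \<omega>) | x. x \<in> Linf_cond P F}"
  then obtain x where x: "x \<in> Linf_cond P F" and h: "h = (\<lambda>\<omega>. ereal (\<langle>x, y\<rangle> \<omega>) - f x \<omega>)" by blast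
  from le[OF x] f_eq_\<rho>[OF x] show "AE \<omega> in P. h \<omega> \<le> u \<omega>"
    unfolding h by eventually_elim simp
qed

lemma bidual_is_ess_Sup:
  "is_ess_Sup P F {(\<lambda>\<omega>. ereal (\<langle>x, y\<rangle> \<omega>) - cond_conjugate P F f y \<omega>) | y. y \<in> dual_elements}
     (ess_Sup P F {(\<lambda>\<omega>. ereal (\<langle>x, y\<rangle> \<omega>) - cond_conjugate P F f y \<omega>) | y. y \<in> dual_elements})"
proof (rule is_ess_Sup_ess_Sup)
  have "(\<lambda>\<omega>. ereal (\<langle>x, y\<rangle> \<omega>) - cond_conjugate P F f y \<omega>) \<in> borel_measurable F" for y
    using cond_conjugate_measurable
    by (intro borel_measurable_ereal_diff borel_measurable_ereal cond_pairing_measurable) auto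
  then show "{(\<lambda>\<omega>. ereal (\<langle>x, y\<rangle> \<omega>) - cond_conjugate P F f y \<omega>) | y. y \<in> dual_elements} \<subseteq> borel_measurable F"
    by blast
qed

text \<open>Off the event \<open>C\<close> on which the separation is strict, the normalised separating element is
  replaced by \<open>-1\<close>, so that it remains an admissible dual element.\<close>

lemma dual_element_exceeding:
  assumes lsc: "lsc_sigma_c P F f" and x: "x \<in> Linf_cond P F" and r: "r \<in> borel_measurable F"
    and less: "\<not> (AE \<omega> in P. \<rho> x \<omega> \<le> r \<omega>)"
  shows "\<exists>y\<in>dual_elements. \<not> (AE \<omega> in P. ereal (\<langle>x, y\<rangle> \<omega>) - cond_conjugate P F f y \<omega> \<le> ereal (r \<omega>))"
proof -
  \<comment> \<open>Cash invariance moves the threshold \<open>r\<close> to 0: the shifted position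
    is acceptable exactly when \<open>\<rho> x\<close> is at most \<open>r\<close> almost
    surely.\<close>
  define x1 where "x1 = (\<lambda>\<omega>. x \<omega> + r \<omega>)"
  have x1: "x1 \<in> Linf_cond P F" unfolding x1_def by (rule Linf_cond_add[OF x F_in_Linf_cond[OF r]])
  have "x1 \<notin> acceptable"
  proof
    assume "x1 \<in> acceptable"
    then have "AE \<omega> in P. \<rho> x1 \<omega> \<le> 0" by (simp add: acceptable_def)
    with \<rho>_cash[OF x r] have "AE \<omega> in P. \<rho> x \<omega> \<le> r \<omega>"
      unfolding x1_def by eventually_elim simp
    with less show False by blast
  qed
  have acc_eq: "acceptable = {x \<in> Linf_cond P F. AE \<omega> in P. f x \<omega> \<le> ereal 0}"
  proof -
    have "(AE \<omega> in P. \<rho> x \<omega> \<le> 0) \<longleftrightarrow> (AE \<omega> in P. f x \<omega> \<le> ereal 0)" if "x \<in> Linf_cond P F" for x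
    proof
      assume "AE \<omega> in P. \<rho> x \<omega> \<le> 0"
      with f_eq_\<rho>[OF that] show "AE \<omega> in P. f x \<omega> \<le> ereal 0" by eventually_elim simp
    next
      assume "AE \<omega> in P. f x \<omega> \<le> ereal 0"
      with f_eq_\<rho>[OF that] show "AE \<omega> in P. \<rho> x \<omega> \<le> 0" by eventually_elim simp
    qed
    then show ?thesis unfolding acceptable_def by (intro Collect_cong) blast
  qed
  have "(\<lambda>_. 0) \<in> borel_measurable F" by simp
  from bspec[OF lsc[unfolded lsc_sigma_c_def] this]
  have "closedin (sigma_c P F) acceptable" unfolding acc_eq .
  then have "openin (sigma_c P F) (Linf_cond P F - acceptable)" by (simp add: closedin_def)
  moreover have "x1 \<in> Linf_cond P F - acceptable" using x1 \<open>x1 \<notin> acceptable\<close> by blast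
  ultimately obtain N where N: "N \<in> sigma_c_base P F" "(\<lambda>z \<omega>. x1 \<omega> + z \<omega>) ` N \<subseteq> Linf_cond P F - acceptable"
    unfolding openin_sigma_c by blast
  then obtain Y \<epsilon> where Y: "N = sigma_c_nbhd P F Y \<epsilon>" "finite Y" "Y \<subseteq> L1_cond P F"
    "\<epsilon> \<in> borel_measurable F" "AE \<omega> in P. 0 < \<epsilon> \<omega>"
    unfolding sigma_c_base_def by blast
  have away: "(\<lambda>\<omega>. z \<omega> - x1 \<omega>) \<notin> sigma_c_nbhd P F Y \<epsilon>" if "z \<in> acceptable" for z
  proof
    assume "(\<lambda>\<omega>. z \<omega> - x1 \<omega>) \<in> sigma_c_nbhd P F Y \<epsilon>"
    then have "(\<lambda>\<omega>. x1 \<omega> + (z \<omega> - x1 \<omega>)) \<in> Linf_cond P F - acceptable"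
      using N(2) unfolding Y(1) by blast
    then show False using that by simp
  qed
  obtain y d where y: "y \<in> L1_cond P F" "AE \<omega> in P. 0 \<le> y \<omega>"
    and d: "d \<in> borel_measurable F" "\<not> (AE \<omega> in P. d \<omega> \<le> 0)"
    "AE \<omega> in P. 0 < d \<omega> \<longrightarrow> 0 < real_cond_exp P F y \<omega>"
    and sep: "\<And>x. x \<in> acceptable \<Longrightarrow> AE \<omega> in P. d \<omega> \<le> \<langle>x, y\<rangle> \<omega> - \<langle>x1, y\<rangle> \<omega>"
    using acceptable_separation[OF x1 Y(2-5) away] by blast
  define c where "c = real_cond_exp P F y"
  have c[measurable]: "c \<in> borel_measurable F" by (simp add: c_def)
  note [measurable] = d(1)
  define C where "C = {\<omega> \<in> space F. 0 < d \<omega> \<and> 0 < c \<omega>}"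
  have C[measurable]: "C \<in> sets F" unfolding C_def by measurable
  define a where "a = (\<lambda>\<omega>. indicator C \<omega> * (- 1 / c \<omega>))"
  define b where "b = (\<lambda>\<omega>. - indicator (space F - C) \<omega> :: real)"
  have a: "a \<in> borel_measurable F" unfolding a_def by measurable
  have b: "b \<in> borel_measurable F" unfolding b_def by measurable
  define y' where "y' = (\<lambda>\<omega>. a \<omega> * y \<omega> + b \<omega> * 1)"
  have ayL: "(\<lambda>\<omega>. a \<omega> * y \<omega>) \<in> L1_cond P F" by (rule L1_cond_F_mult[OF a y(1)])
  have bL: "(\<lambda>\<omega>. b \<omega> * 1) \<in> L1_cond P F" by (rule L1_cond_F_mult[OF b const_in_L1_cond])
  have y'L: "y' \<in> L1_cond P F" unfolding y'_def by (rule L1_cond_add[OF ayL bL])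
  have "AE \<omega> in P. real_cond_exp P F (\<lambda>_. 1) \<omega> = 1" by (intro real_cond_exp_F_meas) auto
  with real_cond_exp_L1_add[OF ayL bL] real_cond_exp_F_mult[OF a L1_cond_measurable[OF y(1)]]
    real_cond_exp_F_mult[OF b borel_measurable_const[of 1]] AE_space
  have Ey': "AE \<omega> in P. real_cond_exp P F y' \<omega> = -1"
    unfolding y'_def by eventually_elim (auto simp: a_def b_def C_def c_def space_F indicator_def)
  have "AE \<omega> in P. y' \<omega> \<le> 0"
    using y(2) AE_space
    by eventually_elim (auto simp: y'_def a_def b_def C_def space_F indicator_def divide_nonneg_pos)
  with Ey' y'L have dual: "y' \<in> dual_elements" by (simp add: dual_elements_def)
  have pair: "AE \<omega> in P. \<omega> \<in> C \<longrightarrow> \<langle>z, y'\<rangle> \<omega> = - \<langle>z, y\<rangle> \<omega> / c \<omega>" if z: "z \<in> Linf_cond P F" for z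
  proof -
    have i: "indicator C \<in> borel_measurable F" by measurable
    have "(\<lambda>\<omega>. indicator C \<omega> * (z \<omega> * y' \<omega>)) = (\<lambda>\<omega>. a \<omega> * (z \<omega> * y \<omega>))"
      by (auto simp: y'_def a_def b_def indicator_def fun_eq_iff)
    with real_cond_exp_F_mult[OF i L1_cond_measurable[OF L1_cond_Linf_mult[OF z y'L]]]
      real_cond_exp_F_mult[OF a L1_cond_measurable[OF L1_cond_Linf_mult[OF z y(1)]]]
    have "AE \<omega> in P. indicator C \<omega> * \<langle>z, y'\<rangle> \<omega> = a \<omega> * \<langle>z, y\<rangle> \<omega>"
      unfolding cond_pairing_def by auto
    then show ?thesis by eventually_elim (auto simp: a_def)
  qed
  \<comment> \<open>An upper bound for the conjugate of \<open>y'\<close>. On \<open>C\<close> it is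
    the separation inequality divided by \<open>-c\<close>; off \<open>C\<close> nothing is known,
    so the bound is infinite.\<close>
  define u where "u = (\<lambda>\<omega>. if \<omega> \<in> C then ereal (\<langle>x1, y'\<rangle> \<omega> - d \<omega> / c \<omega>) else \<infinity>)"
  have "u \<in> borel_measurable F" unfolding u_def by measurable
  then have conj: "AE \<omega> in P. cond_conjugate P F f y' \<omega> \<le> u \<omega>"
  proof (rule cond_conjugate_least)
    fix z assume z: "z \<in> Linf_cond P F"
    define k where "k = (\<lambda>\<omega>. z \<omega> + \<rho> z \<omega>)"
    have k: "k \<in> acceptable" unfolding k_def by (rule acceptable_shift[OF z])
    have \<rho>z: "\<rho> z \<in> borel_measurable F" by (rule \<rho>_measurable[OF z])
    \<comment> \<open>The normalisation of \<open>y'\<close> to conditional expectation -1 makes the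
      conjugate's term at \<open>z\<close> the pairing of \<open>y'\<close> with the acceptable
      position \<open>k\<close>, to which separation applies.\<close>
    have "AE \<omega> in P. \<langle>k, y'\<rangle> \<omega> = \<langle>z, y'\<rangle> \<omega> - \<rho> z \<omega>"
      using cond_pairing_add[OF z F_in_Linf_cond[OF \<rho>z] y'L] cond_pairing_F[OF \<rho>z y'L] Ey'
      unfolding k_def by eventually_elim simp
    with sep[OF k] pair[OF acceptable_Linf[OF k]] pair[OF x1]
    show "AE \<omega> in P. ereal (\<langle>z, y'\<rangle> \<omega> - \<rho> z \<omega>) \<le> u \<omega>"
    proof eventually_elim
      case (elim \<omega>)
      show ?case
      proof (cases "\<omega> \<in> C")
        case True
        then have "c \<omega> > 0" by (simp add: C_def)
        then have "d \<omega> / c \<omega> \<le> (\<langle>k, y\<rangle> \<omega> - \<langle>x1, y\<rangle> \<omega>) / c \<omega>"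
          using elim(1) by (intro divide_right_mono) auto
        then show ?thesis using True elim by (simp add: u_def diff_divide_distrib)
      qed (simp add: u_def)
    qed
  qed
  have "\<not> (AE \<omega> in P. ereal (\<langle>x, y'\<rangle> \<omega>) - cond_conjugate P F f y' \<omega> \<le> ereal (r \<omega>))"
  proof
    assume "AE \<omega> in P. ereal (\<langle>x, y'\<rangle> \<omega>) - cond_conjugate P F f y' \<omega> \<le> ereal (r \<omega>)"
    moreover have "AE \<omega> in P. \<langle>x1, y'\<rangle> \<omega> = \<langle>x, y'\<rangle> \<omega> - r \<omega>"
      using cond_pairing_add[OF x F_in_Linf_cond[OF r] y'L] cond_pairing_F[OF r y'L] Ey'
      unfolding x1_def by eventually_elim simp
    \<comment> \<open>Where \<open>d\<close> is positive, the bound \<open>u\<close> gives pairing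
      minus conjugate >= r + d/c > r, contradicting the assumption; so \<open>d\<close> would be
      nonpositive almost surely.\<close>
    ultimately have "AE \<omega> in P. d \<omega> \<le> 0"
      using conj d(3) AE_space
    proof eventually_elim
      case (elim \<omega>)
      show ?case
      proof (rule ccontr)
        assume pos: "\<not> d \<omega> \<le> 0"
        then have "c \<omega> > 0" using elim by (simp add: c_def)
        then have "\<omega> \<in> C" "d \<omega> / c \<omega> > 0" using pos elim by (auto simp: C_def space_F)
        then show False using elim(1-3)
          by (cases "cond_conjugate P F f y' \<omega>") (auto simp: u_def)
      qed
    qed
    with d(2) show False by blast
  qed
  with dual show ?thesis by blast
qed

text \<open>The supremum \<open>g\<close> is at most \<open>f x\<close> by the Fenchel-Young
  inequality. Conversely, by \<open>dual_element_exceeding\<close> every real F-measurable bound of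
  the dual values dominates \<open>\<rho> x\<close>; this is applied to a bound lying strictly below
  \<open>\<rho> x\<close> wherever \<open>g\<close> does.\<close>

lemma lsc_sigma_c_imp_representable:
  assumes lsc: "lsc_sigma_c P F f"
  shows "representable"
  unfolding representable_def
proof
  fix x assume x: "x \<in> Linf_cond P F"
  define S where "S = {(\<lambda>\<omega>. ereal (\<langle>x, y\<rangle> \<omega>) - cond_conjugate P F f y \<omega>) | y. y \<in> dual_elements}"
  define g where "g = ess_Sup P F S"
  have g: "is_ess_Sup P F S g" unfolding g_def S_def by (rule bidual_is_ess_Sup)
  have gm[measurable]: "g \<in> borel_measurable F" using g by (simp add: is_ess_Sup_def)
  have [measurable]: "\<rho> x \<in> borel_measurable F" by (rule \<rho>_measurable[OF x])
  have upper: "AE \<omega> in P. g \<omega> \<le> f x \<omega>"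
  proof (rule is_ess_Sup_least[OF g f_measurable[OF x]])
    fix h assume "h \<in> S"
    then obtain y where h: "h = (\<lambda>\<omega>. ereal (\<langle>x, y\<rangle> \<omega>) - cond_conjugate P F f y \<omega>)"
      unfolding S_def by blast
    from fenchel_young[OF x, of y] f_eq_\<rho>[OF x] show "AE \<omega> in P. h \<omega> \<le> f x \<omega>"
      unfolding h
    proof eventually_elim
      case (elim \<omega>)
      then show ?case by (cases "cond_conjugate P F f y \<omega>") auto
    qed
  qed
  \<comment> \<open>The midpoint between \<open>\<rho> x\<close> and \<open>g\<close>, with
    \<open>g\<close> cut off below at \<open>\<rho> x - 1\<close> so that \<open>r\<close> stays
    real where \<open>g\<close> is minus infinity.\<close>
  define r where "r = (\<lambda>\<omega>. (\<rho> x \<omega> + real_of_ereal (max (g \<omega>) (ereal (\<rho> x \<omega> - 1)))) / 2)"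
  have r: "r \<in> borel_measurable F" unfolding r_def by measurable
  have "AE \<omega> in P. g \<omega> \<le> ereal (r \<omega>)"
    using upper f_eq_\<rho>[OF x]
  proof eventually_elim
    case (elim \<omega>)
    then show ?case by (cases "g \<omega>") (auto simp: r_def max_def field_simps)
  qed
  then have "AE \<omega> in P. ereal (\<langle>x, y\<rangle> \<omega>) - cond_conjugate P F f y \<omega> \<le> ereal (r \<omega>)"
    if "y \<in> dual_elements" for y
  proof -
    have "(\<lambda>\<omega>. ereal (\<langle>x, y\<rangle> \<omega>) - cond_conjugate P F f y \<omega>) \<in> S" using that unfolding S_def by blast
    from is_ess_Sup_upper[OF g this] \<open>AE \<omega> in P. g \<omega> \<le> ereal (r \<omega>)\<close>
    show ?thesis by eventually_elim (rule order_trans)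
  qed
  then have "AE \<omega> in P. \<rho> x \<omega> \<le> r \<omega>"
    using dual_element_exceeding[OF lsc x r] by blast
  with upper f_eq_\<rho>[OF x] have "AE \<omega> in P. f x \<omega> = g \<omega>"
  proof eventually_elim
    case (elim \<omega>)
    then show ?case by (cases "g \<omega>") (auto simp: r_def max_def field_simps split: if_splits)
  qed
  then show "AE \<omega> in P. f x \<omega> =
     ess_Sup P F {(\<lambda>\<omega>. ereal (\<langle>x, y\<rangle> \<omega>) - cond_conjugate P F f y \<omega>) | y. y \<in> dual_elements} \<omega>"
    unfolding g_def S_def .
qed

text \<open>At a point outside the epigraph some dual element exceeds \<open>r0\<close> on a
  non-null event, hence by a fixed margin on an event of positive probability. Open strips around
  \<open>x0\<close> and \<open>r0\<close> whose exceptional sets are too small to cover that event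
  give a product neighbourhood missing the epigraph.\<close>

lemma representable_imp_lsc_sigma_el:
  assumes rep: representable
  shows "lsc_sigma_el P F f"
proof -
  define G where "G = {(x, r). x \<in> Linf_cond P F \<and> r \<in> borel_measurable F \<and> (AE \<omega> in P. f x \<omega> \<le> ereal (r \<omega>))}"
  let ?T = "prod_topology (sigma_el P F) (prob_topology P F)"
  have "\<exists>U V. openin (sigma_el P F) U \<and> openin (prob_topology P F) V \<and> x0 \<in> U \<and> r0 \<in> V \<and>
      U \<times> V \<subseteq> Linf_cond P F \<times> borel_measurable F - G"
    if "(x0, r0) \<in> Linf_cond P F \<times> borel_measurable F - G" for x0 r0
  proof -
    have x0: "x0 \<in> Linf_cond P F" and r0: "r0 \<in> borel_measurable F"
      and notG: "\<not> (AE \<omega> in P. f x0 \<omega> \<le> ereal (r0 \<omega>))"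
      using that by (auto simp: G_def)
    have "\<exists>y\<in>dual_elements. \<not> (AE \<omega> in P. ereal (\<langle>x0, y\<rangle> \<omega>) - cond_conjugate P F f y \<omega> \<le> ereal (r0 \<omega>))"
    proof (rule ccontr)
      assume no: "\<not> ?thesis"
      have r0e: "(\<lambda>\<omega>. ereal (r0 \<omega>)) \<in> borel_measurable F" using r0 by auto
      have "AE \<omega> in P. ess_Sup P F {(\<lambda>\<omega>. ereal (\<langle>x0, y\<rangle> \<omega>) - cond_conjugate P F f y \<omega>) | y. y \<in> dual_elements} \<omega>
          \<le> ereal (r0 \<omega>)"
        by (rule is_ess_Sup_least[OF bidual_is_ess_Sup r0e]) (use no in blast)
      moreover have "AE \<omega> in P. f x0 \<omega> =
          ess_Sup P F {(\<lambda>\<omega>. ereal (\<langle>x0, y\<rangle> \<omega>) - cond_conjugate P F f y \<omega>) | y. y \<in> dual_elements} \<omega>"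
        using rep x0 unfolding representable_def by (rule bspec)
      ultimately have "AE \<omega> in P. f x0 \<omega> \<le> ereal (r0 \<omega>)" by eventually_elim simp
      with notG show False by blast
    qed
    then obtain y where y: "y \<in> dual_elements"
      and exc: "\<not> (AE \<omega> in P. ereal (\<langle>x0, y\<rangle> \<omega>) - cond_conjugate P F f y \<omega> \<le> ereal (r0 \<omega>))"
      by blast
    have yL: "y \<in> L1_cond P F" using y by (simp add: dual_elements_def)
    define \<phi> where "\<phi> = cond_conjugate P F f y"
    have [measurable]: "\<phi> \<in> borel_measurable P" "r0 \<in> borel_measurable P" "\<langle>z, y\<rangle> \<in> borel_measurable P" for z
      unfolding \<phi>_def using r0 by (auto intro: measurable_F cond_conjugate_measurable cond_pairing_measurable)
    \<comment> \<open>The margin is twice 1/(n+1): one half absorbs the variation of the pairing,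
      the other that of \<open>r\<close>.\<close>
    define B where "B = (\<lambda>n. {\<omega> \<in> space P. \<phi> \<omega> < ereal (\<langle>x0, y\<rangle> \<omega> - r0 \<omega> - 2 * inverse (real (Suc n)))})"
    have B[measurable]: "B n \<in> sets P" for n unfolding B_def by measurable
    have "\<exists>n. prob (B n) > 0"
    proof (rule ccontr)
      assume "\<not> ?thesis"
      then have "prob (B n) = 0" for n by (meson measure_nonneg not_less order_antisym)
      then have "AE \<omega> in P. \<omega> \<notin> B n" for n using B by (simp add: prob_eq_0)
      then have "AE \<omega> in P. \<forall>n. \<omega> \<notin> B n" by (simp add: AE_all_countable)
      with AE_space fenchel_young[OF x0, of y]
      have "AE \<omega> in P. ereal (\<langle>x0, y\<rangle> \<omega>) - \<phi> \<omega> \<le> ereal (r0 \<omega>)"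
      proof eventually_elim
        case (elim \<omega>)
        show ?case
        proof (cases "\<phi> \<omega>")
          case (real p)
          have "\<not> p < \<langle>x0, y\<rangle> \<omega> - r0 \<omega>"
          proof
            assume "p < \<langle>x0, y\<rangle> \<omega> - r0 \<omega>"
            then obtain n where "inverse (real (Suc n)) < (\<langle>x0, y\<rangle> \<omega> - r0 \<omega> - p) / 2"
              using reals_Archimedean[of "(\<langle>x0, y\<rangle> \<omega> - r0 \<omega> - p) / 2"] by auto
            then have "p < \<langle>x0, y\<rangle> \<omega> - r0 \<omega> - 2 * inverse (real (Suc n))"
              by (simp add: algebra_simps del: of_nat_Suc)
            then have "\<omega> \<in> B n" using elim(1) real by (simp add: B_def del: of_nat_Suc)
            then show False using elim(3) by blast
          qed
          then show ?thesis using real by simp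
        qed (use elim(2) in \<open>auto simp: \<phi>_def\<close>)
      qed
      with exc show False unfolding \<phi>_def by blast
    qed
    then obtain n where n: "prob (B n) > 0" by blast
    define \<epsilon> where "\<epsilon> = inverse (real (Suc n))"
    have \<epsilon>: "\<epsilon> > 0" by (simp add: \<epsilon>_def)
    \<comment> \<open>Each strip fails with probability below half that of \<open>B n\<close>, so
      both conditions hold together on a non-null part of \<open>B n\<close>.\<close>
    define a where "a = 1 - prob (B n) / 2"
    have a: "a < 1" using n by (simp add: a_def)
    define U where "U = {x \<in> Linf_cond P F. a < prob {\<omega> \<in> space P. \<bar>\<langle>\<lambda>\<omega>. x \<omega> - x0 \<omega>, y\<rangle> \<omega>\<bar> < \<epsilon>}}"
    define V where "V = {r \<in> borel_measurable F. a < prob {\<omega> \<in> space P. \<bar>r \<omega> - r0 \<omega>\<bar> < \<epsilon>}}"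
    have "AE \<omega> in P. \<langle>\<lambda>\<omega>. x0 \<omega> - x0 \<omega>, y\<rangle> \<omega> = 0"
      using cond_pairing_diff[OF x0 x0 yL] by eventually_elim simp
    then have "AE \<omega> in P. \<bar>\<langle>\<lambda>\<omega>. x0 \<omega> - x0 \<omega>, y\<rangle> \<omega>\<bar> < \<epsilon>" by eventually_elim (simp add: \<epsilon>)
    then have "prob {\<omega> \<in> space P. \<bar>\<langle>\<lambda>\<omega>. x0 \<omega> - x0 \<omega>, y\<rangle> \<omega>\<bar> < \<epsilon>} = 1"
      by (subst prob_Collect_eq_1) measurable
    then have "x0 \<in> U" unfolding U_def using x0 a by simp
    moreover have "r0 \<in> V" unfolding V_def using r0 a \<epsilon> by (simp add: prob_space)
    moreover have "openin (sigma_el P F) U" unfolding U_def by (rule openin_sigma_el_strip[OF x0 yL])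
    moreover have "openin (prob_topology P F) V" unfolding V_def by (rule openin_prob_topology_strip[OF r0])
    moreover have "(x, r) \<notin> G" if xU: "x \<in> U" and rV: "r \<in> V" for x r
    proof
      assume "(x, r) \<in> G"
      then have x: "x \<in> Linf_cond P F" and r: "r \<in> borel_measurable F"
        and le: "AE \<omega> in P. f x \<omega> \<le> ereal (r \<omega>)" by (auto simp: G_def)
      have [measurable]: "r \<in> borel_measurable P" using r by (rule measurable_F)
      let ?A1 = "{\<omega> \<in> space P. \<bar>\<langle>\<lambda>\<omega>. x \<omega> - x0 \<omega>, y\<rangle> \<omega>\<bar> < \<epsilon>}"
      let ?A2 = "{\<omega> \<in> space P. \<bar>r \<omega> - r0 \<omega>\<bar> < \<epsilon>}"
      have "AE \<omega> in P. \<not> (\<omega> \<in> B n \<and> \<omega> \<in> ?A1 \<and> \<omega> \<in> ?A2)"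
        using le fenchel_young[OF x, of y] f_eq_\<rho>[OF x] cond_pairing_diff[OF x x0 yL]
      proof eventually_elim
        case (elim \<omega>)
        show ?case
        proof
          \<comment> \<open>Here \<rho> x <= r < r0 + \<epsilon>, while the pairing at
            \<open>x\<close> exceeds that at \<open>x0\<close> minus \<epsilon>. Their difference is
            thus above the bound that Fenchel-Young and \<open>B n\<close> impose.\<close>
          assume *: "\<omega> \<in> B n \<and> \<omega> \<in> ?A1 \<and> \<omega> \<in> ?A2"
          have "\<rho> x \<omega> \<le> r \<omega>" using elim(1,3) by simp
          moreover have "ereal (\<langle>x, y\<rangle> \<omega> - \<rho> x \<omega>) < ereal (\<langle>x0, y\<rangle> \<omega> - r0 \<omega> - 2 * \<epsilon>)"
            using elim(2) * unfolding \<phi>_def[symmetric] B_def \<epsilon>_def by (blast intro: le_less_trans)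
          ultimately show False using * elim(4) by simp linarith
        qed
      qed
      then have "prob (B n \<inter> (?A1 \<inter> ?A2)) = 0"
        by (subst prob_eq_0) auto
      moreover have "prob (?A1 \<inter> ?A2) = prob ?A1 + prob ?A2 - prob (?A1 \<union> ?A2)"
        by (subst measure_Un3) (auto simp: fmeasurable_eq_sets)
      moreover have "prob (B n \<inter> (?A1 \<inter> ?A2)) = prob (B n) + prob (?A1 \<inter> ?A2) - prob (B n \<union> (?A1 \<inter> ?A2))"
        by (subst measure_Un3) (auto simp: fmeasurable_eq_sets)
      moreover have "prob (?A1 \<union> ?A2) \<le> 1" "prob (B n \<union> (?A1 \<inter> ?A2)) \<le> 1" by simp_all
      moreover have "a < prob ?A1" "a < prob ?A2" using xU rV by (simp_all add: U_def V_def)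
      ultimately show False unfolding a_def by linarith
    qed
    moreover have "U \<subseteq> Linf_cond P F" "V \<subseteq> borel_measurable F" by (auto simp: U_def V_def)
    ultimately show ?thesis by (intro exI[of _ U] exI[of _ V]) auto
  qed
  then have "openin ?T (Linf_cond P F \<times> borel_measurable F - G)"
    unfolding openin_prod_topology_alt by blast
  moreover have "G \<subseteq> Linf_cond P F \<times> borel_measurable F" by (auto simp: G_def)
  ultimately show ?thesis unfolding lsc_sigma_el_def G_def[symmetric] by (simp add: closedin_def)
qed

end

section \<open>Equivalence of the semicontinuity notions and the dual representation\<close>

theorem theorem4p17:
  fixes P F :: "'a measure" and f :: "('a \<Rightarrow> real) \<Rightarrow> 'a \<Rightarrow> ereal"
  assumes "prob_space P"
    and "subalgebra P F"
    and "cond_risk_measure P F f"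
    and "L0_convex P F f"
  shows "(lsc_sigma_el P F f \<longleftrightarrow> lsc_sigma_c P F f) \<and>
    (lsc_sigma_el P F f \<or> lsc_sigma_c P F f \<longrightarrow>
      (\<forall>x\<in>Linf_cond P F. AE \<omega> in P. f x \<omega> =
         ess_Sup P F {(\<lambda>\<omega>. ereal (cond_pairing P F x y \<omega>) - cond_conjugate P F f y \<omega>) | y.
           y \<in> L1_cond P F \<and> (AE \<omega> in P. y \<omega> \<le> 0) \<and> (AE \<omega> in P. real_cond_exp P F y \<omega> = -1)} \<omega>))"
proof -
  interpret prob_space P by fact
  interpret convex_risk_measure P F f by unfold_locales fact+
  have "representable" if "lsc_sigma_c P F f" using that by (rule lsc_sigma_c_imp_representable)
  then show ?thesis
    using lsc_sigma_el_imp_lsc_sigma_c representable_imp_lsc_sigma_el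
    unfolding representable_def dual_elements_def mem_Collect_eq by blast
qed

end
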